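(* Consider the system $\dot x=f(x)$, where $f:\mathbb{R}^n\to\mathbb{R}^n$ is piecewise $\mathcal C^2$ and locally Lipschitz in a neighborhood of a $p$-dimensional submanifold $\mathcal E\subset\mathbb{R}^n$ of equilibrium points of the system. For $x_*\in\mathcal E$ let $\{A_{x_*,i}\}_{i\in\mathcal I_{x_*}}$, with $\mathcal I_{x_*}$ a finite index set, be the matrices in $\mathbb{R}^{n\times n}$ with $$\{A_{x_*,i}\mid i\in\mathcal I_{x_*}\}=\Big\{\lim_{k\to\infty}Df(x_k)\;\Big|\;x_k\to x_*,\ x_k\in\mathbb{R}^n\setminus\Omega_f\Big\},$$ where $\Omega_f$ is the set of points where $f$ is not differentiable. Assume that at each $x_*\in\mathcal E$ these matrices satisfy: (i) there exists an orthogonal matrix $Q\in\mathbb{R}^{n\times n}$ such that, for all $i\in\mathcal I_{x_*}$, $$Q^\top A_{x_*,i}Q=\begin{bmatrix}0&0\\0&\tilde A_{x_*,i}\end{bmatrix},\qquad\tilde A_{x_*,i}\in\mathbb{R}^{(n-p)\times(n-p)};$$ (ii) the eigenvalues of the matrices $\{\tilde A_{x_*,i}\}_{i\in\mathcal I_{x_*}}$ have negative real parts; (iii) there exists a positive definite matrix $P\in\mathbb{R}^{(n-p)\times(n-p)}$ such that $\tilde A_{x_*,i}^\top P+P\tilde A_{x_*,i}\prec0$ for all $i\in\mathcal I_{x_*}$. Then $\mathcal E$ is locally asymptotically stable under $\dot x=f(x)$ and the trajectories converge to a point in $\mathcal E$.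
   Context: Piecewise $\mathcal C^2$: a vector field $f:\mathbb{R}^n\to\mathbb{R}^n$ is piecewise $\mathcal C^2$ if it is continuous and there exist (1) a finite collection of disjoint open sets (patches) $\mathcal D_1,\dots,\mathcal D_m\subset\mathbb{R}^n$ with $\mathbb{R}^n=\bigcup_{i=1}^m\mathrm{cl}(\mathcal D_i)$ and (2) $\mathcal C^2$ functions $f_i:\mathcal D_i^e\to\mathbb{R}^n$, $i=1,\dots,m$, with $\mathcal D_i^e$ open and $\mathrm{cl}(\mathcal D_i)\subset\mathcal D_i^e$, such that $f$ and $f_i$ coincide on $\mathrm{cl}(\mathcal D_i)$. For such $f$ the set of limits of Jacobians displayed in the claim is finite. $Df$ denotes the Jacobian; $M\prec0$ means $M$ is negative definite. Stability: a set $\mathcal E$ of equilibria is locally asymptotically stable if (a) for every $\epsilon>0$ there is an open set $W\supset\mathcal E$ such that every trajectory starting in $W$ stays within distance less than $\epsilon$ of $\mathcal E$ for all $t\ge0$, and (b) there is an open set $W\supset\mathcal E$ such that the distance to $\mathcal E$ of every trajectory starting in $W$ tends to $0$ as $t\to\infty$. "The trajectories converge to a point in $\mathcal E$" means that the trajectories starting in some open set containing $\mathcal E$ each converge to a single point of $\mathcal E$. *)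

theory Defs
  imports "HOL-Analysis.Analysis" "Jordan_Normal_Form.Char_Poly"
begin

text \<open>Differentiability classes, to be used on open sets only.\<close>

definition C1_on :: "('a::real_normed_vector \<Rightarrow> 'b::real_normed_vector) \<Rightarrow> 'a set \<Rightarrow> bool" where
  "C1_on g S \<longleftrightarrow>
     (\<exists>g' :: 'a \<Rightarrow> 'a \<Rightarrow>\<^sub>L 'b.
        (\<forall>x\<in>S. (g has_derivative blinfun_apply (g' x)) (at x)) \<and> continuous_on S g')"

definition C2_on :: "('a::real_normed_vector \<Rightarrow> 'b::real_normed_vector) \<Rightarrow> 'a set \<Rightarrow> bool" where
  "C2_on g S \<longleftrightarrow>
     (\<exists>g' :: 'a \<Rightarrow> 'a \<Rightarrow>\<^sub>L 'b.
        (\<forall>x\<in>S. (g has_derivative blinfun_apply (g' x)) (at x)) \<and> C1_on g' S)"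

definition piecewise_C2 :: "('a::euclidean_space \<Rightarrow> 'a) \<Rightarrow> bool" where
  "piecewise_C2 f \<longleftrightarrow>
     continuous_on UNIV f \<and>
     (\<exists>\<D>. finite \<D> \<and> disjoint \<D> \<and> (\<forall>D\<in>\<D>. open D) \<and> (\<Union>D\<in>\<D>. closure D) = UNIV \<and>
        (\<forall>D\<in>\<D>. \<exists>De g. open De \<and> closure D \<subseteq> De \<and> C2_on g De \<and> (\<forall>x\<in>closure D. f x = g x)))"

text \<open>Embedded submanifolds, given by slice charts. Only class \<open>C\<^sup>1\<close> is required of the charts.
  The manifold need be neither closed nor connected nor nonempty.\<close>

definition submanifold :: "nat \<Rightarrow> 'a::euclidean_space set \<Rightarrow> bool" where
  "submanifold p M \<longleftrightarrow>
     (\<forall>x\<in>M. \<exists>U V \<phi> \<psi> S.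
        open U \<and> x \<in> U \<and> open V \<and> homeomorphism U V \<phi> \<psi> \<and>
        C1_on \<phi> U \<and> C1_on \<psi> V \<and>
        subspace (S :: 'a set) \<and> dim S = p \<and> \<phi> ` (M \<inter> U) = S \<inter> V)"

definition limiting_jacobians :: "(real^'n \<Rightarrow> real^'n) \<Rightarrow> real^'n \<Rightarrow> (real^'n^'n) set" where
  "limiting_jacobians f x =
     {A. \<exists>X. X \<longlonglongrightarrow> x \<and> (\<forall>k. f differentiable at (X k)) \<and>
             (\<lambda>k. jacobian f (at (X k))) \<longlonglongrightarrow> A}"

text \<open>Blocks whose size depends on a natural number are dimension-carrying matrices (type \<open>mat\<close>).
  A square matrix indexed by the type \<open>'n\<close> is read as such a matrix along one fixed enumeration of
  the coordinates; \<open>from_nat_into UNIV\<close> is a bijection from \<open>{..<CARD('n)}\<close> onto the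
  index type.\<close>

definition mat_of :: "real^'n^'n \<Rightarrow> real mat" where
  "mat_of A = mat CARD('n) CARD('n)
     (\<lambda>(i, j). vec_nth (vec_nth A (from_nat_into UNIV i)) (from_nat_into UNIV j))"

definition positive_definite :: "real mat \<Rightarrow> bool" where
  "positive_definite M \<longleftrightarrow>
     square_mat M \<and> transpose_mat M = M \<and>
     (\<forall>v\<in>carrier_vec (dim_row M). v \<noteq> 0\<^sub>v (dim_row M) \<longrightarrow> 0 < scalar_prod v (M *\<^sub>v v))"

definition negative_definite :: "real mat \<Rightarrow> bool" where
  "negative_definite M \<longleftrightarrow> positive_definite (- M)"

definition solves_forward :: "('a::real_normed_vector \<Rightarrow> 'a) \<Rightarrow> ereal \<Rightarrow> (real \<Rightarrow> 'a) \<Rightarrow> bool" where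
  "solves_forward f T x \<longleftrightarrow>
     0 < T \<and>
     (\<forall>t. 0 \<le> t \<and> ereal t < T \<longrightarrow>
        (x has_vector_derivative f (x t)) (at t within {s. 0 \<le> s \<and> ereal s < T}))"

text \<open>A trajectory is a solution on \<open>[0, T)\<close> that has no extension to a larger interval
  \<open>[0, T')\<close>, possibly with \<open>T = \<infinity>\<close>. Maximality is demanded here, and \<open>T = \<infinity>\<close> is
  part of the stability notions below, so that trajectories escaping in finite time are not
  disregarded. The values of \<open>x\<close> outside \<open>[0, T)\<close> are irrelevant.\<close>

definition trajectory :: "('a::real_normed_vector \<Rightarrow> 'a) \<Rightarrow> ereal \<Rightarrow> (real \<Rightarrow> 'a) \<Rightarrow> bool" where
  "trajectory f T x \<longleftrightarrow>
     solves_forward f T x \<and>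
     \<not> (\<exists>T' y. T < T' \<and> solves_forward f T' y \<and> (\<forall>t. 0 \<le> t \<and> ereal t < T \<longrightarrow> y t = x t))"

definition locally_asymptotically_stable ::
  "('a::real_normed_vector \<Rightarrow> 'a) \<Rightarrow> 'a set \<Rightarrow> bool" where
  "locally_asymptotically_stable f E \<longleftrightarrow>
     (\<forall>\<epsilon>>0. \<exists>W. open W \<and> E \<subseteq> W \<and>
        (\<forall>T x. trajectory f T x \<and> x 0 \<in> W \<longrightarrow> T = \<infinity> \<and> (\<forall>t\<ge>0. infdist (x t) E < \<epsilon>))) \<and>
     (\<exists>W. open W \<and> E \<subseteq> W \<and>
        (\<forall>T x. trajectory f T x \<and> x 0 \<in> W \<longrightarrow>
           T = \<infinity> \<and> ((\<lambda>t. infdist (x t) E) \<longlongrightarrow> 0) at_top))"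

definition trajectories_converge_to_point ::
  "('a::real_normed_vector \<Rightarrow> 'a) \<Rightarrow> 'a set \<Rightarrow> bool" where
  "trajectories_converge_to_point f E \<longleftrightarrow>
     (\<exists>W. open W \<and> E \<subseteq> W \<and>
        (\<forall>T x. trajectory f T x \<and> x 0 \<in> W \<longrightarrow> T = \<infinity> \<and> (\<exists>z\<in>E. (x \<longlongrightarrow> z) at_top)))"

end

theory Submission
  imports Defs
begin

text \<open>
  Near \<open>x \<in> E\<close> write \<open>P = Q diag(0, P\<^sub>m) Q\<^sup>T\<close> with \<open>P\<^sub>m\<close> the matrix of hypothesis (iii). The energy
  \<open>W y = f y \<bullet> P (f y)\<close> of the velocity is used as Lyapunov function, so that \<open>E\<close> need not be
  straightened: along a trajectory \<open>f\<close> changes by \<open>dt M (f y)\<close> with \<open>M\<close> close to one of the finitely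
  many limiting Jacobians, and (iii) makes \<open>W\<close> decay exponentially as long as
  \<open>norm (f y) \<le> C * norm (P (f y))\<close>.
  That bound holds because every \<open>y\<close> near \<open>x\<close> lies over a point \<open>z\<close> of \<open>E\<close> with \<open>y - z\<close> in the range
  of \<open>P\<close> (the tangent space of \<open>E\<close> is the kernel of \<open>P\<close>, by a dimension count), and on the segment
  from \<open>z\<close> to \<open>y\<close> hypothesis (iii) applies again. The speed is therefore integrable, the trajectory
  has finite length proportional to \<open>sqrt (W (x 0))\<close>, and its limit is a zero of \<open>f\<close>, hence a point of \<open>E\<close>.
\<close>

subsection \<open>Dini derivatives\<close>

text \<open>Along a trajectory, \<open>f (x t)\<close> need not be differentiable in
  \<open>t\<close>, and the matrix that realizes its increment may vary with \<open>t\<close>. Hence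
  only upper right slopes are estimated, each with an arbitrary slack \<open>\<delta>\<close>, and
  two Dini lemmas replace the integration of differential inequalities. The linearization error
  \<open>\<epsilon> * norm d\<close> involves the whole velocity \<open>d\<close>, whereas the
  dissipation from (iii) controls only \<open>norm (P d)\<close>, because \<open>P\<close>
  degenerates along \<open>E\<close>. This mismatch is why the velocity has to be bounded by its
  image under \<open>P\<close>; \<open>\<epsilon>\<close> is then chosen so that the error consumes
  at most half of the dissipation. Finiteness of the set of matrices makes the strict inequalities
  of (iii) uniform. The matrices used in the estimates are derivatives at \<open>x\<close> of the
  extended pieces. Since the patches are open, each of them is a limiting Jacobian, so the
  hypotheses apply to it. Stability as defined includes \<open>T = \<infinity>\<close>. A trajectory
  of finite length has a limit at a finite end time, and a local solution started there would
  contradict maximality.\<close>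

lemma Dini_upper_bound:
  fixes \<phi> :: "real \<Rightarrow> real"
  assumes ab: "a \<le> b"
    and cont: "continuous_on {a..b} \<phi>"
    and slope: "\<And>s \<delta>. a \<le> s \<Longrightarrow> s < b \<Longrightarrow> 0 < \<delta> \<Longrightarrow>
      \<forall>\<^sub>F t in at_right s. \<phi> t \<le> \<phi> s + (m + \<delta>) * (t - s)"
  shows "\<phi> b \<le> \<phi> a + m * (b - a)"
proof (rule field_le_epsilon)
  fix e :: real assume "0 < e"
  \<comment> \<open>The extra slope \<open>\<eta>\<close> costs at most \<open>e\<close> over the
    whole interval; the summand 1 covers \<open>a = b\<close>.\<close>
  define \<eta> where "\<eta> = e / (b - a + 1)"
  have \<eta>: "0 < \<eta>" "\<eta> * (b - a) \<le> e"
    using \<open>0 < e\<close> ab by (auto simp: \<eta>_def field_simps)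
  \<comment> \<open>Continuous induction: at the last time \<open>\<tau>\<close> where the bound
    with slope \<open>m + \<eta>\<close> holds, the slope hypothesis with slack
    \<open>\<eta>\<close> would carry the bound further if \<open>\<tau> < b\<close>.\<close>
  define S where "S = {t \<in> {a..b}. \<phi> t - (m + \<eta>) * (t - a) \<le> \<phi> a}"
  have "closed S"
    unfolding S_def by (intro continuous_on_closed_Collect_le continuous_intros cont)
  moreover have "bounded S"
    unfolding S_def by (rule bounded_subset[of "{a..b}"]) auto
  ultimately have "compact S" by (simp add: compact_eq_bounded_closed)
  moreover have "a \<in> S" using ab by (simp add: S_def)
  ultimately obtain \<tau> where \<tau>: "\<tau> \<in> S" "\<And>t. t \<in> S \<Longrightarrow> t \<le> \<tau>"
    using compact_attains_sup[of S] by auto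
  have "\<tau> = b"
  proof (rule ccontr)
    assume "\<tau> \<noteq> b"
    with \<tau>(1) have "a \<le> \<tau>" "\<tau> < b" by (auto simp: S_def)
    have "\<forall>\<^sub>F t in at_right \<tau>. \<tau> < t \<and> t < b"
      using \<open>\<tau> < b\<close> by (auto simp: eventually_at_right)
    with slope[OF \<open>a \<le> \<tau>\<close> \<open>\<tau> < b\<close> \<eta>(1)]
    have "\<forall>\<^sub>F t in at_right \<tau>. \<phi> t \<le> \<phi> \<tau> + (m + \<eta>) * (t - \<tau>) \<and> \<tau> < t \<and> t < b"
      by (rule eventually_conj)
    then obtain t where t: "\<phi> t \<le> \<phi> \<tau> + (m + \<eta>) * (t - \<tau>)" "\<tau> < t" "t < b"
      using eventually_happens'[OF trivial_limit_at_right_real] by blast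
    have "t \<in> S" using t \<tau>(1) \<open>a \<le> \<tau>\<close> by (auto simp: S_def algebra_simps)
    with \<tau>(2) t(2) show False by force
  qed
  with \<tau>(1) have "\<phi> b \<le> \<phi> a + (m + \<eta>) * (b - a)" by (auto simp: S_def)
  also have "\<dots> \<le> \<phi> a + m * (b - a) + e" using \<eta>(2) by (simp add: algebra_simps)
  finally show "\<phi> b \<le> \<phi> a + m * (b - a) + e" .
qed

text \<open>The integrating factor \<open>exp (\<kappa> * t)\<close> reduces decay to the previous
  lemma with slope 0. As \<open>W\<close> need not be differentiable, the product rule is replaced
  by an estimate with the difference quotient of the exponential alone.\<close>

lemma Dini_exponential_decay:
  fixes W :: "real \<Rightarrow> real"
  assumes ab: "a \<le> b"
    and cont: "continuous_on {a..b} W"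
    and slope: "\<And>s \<delta>. a \<le> s \<Longrightarrow> s < b \<Longrightarrow> 0 < \<delta> \<Longrightarrow>
      \<forall>\<^sub>F t in at_right s. W t \<le> W s + (\<delta> - \<kappa> * W s) * (t - s)"
  shows "W b \<le> W a * exp (- \<kappa> * (b - a))"
proof -
  define \<phi> where "\<phi> t = exp (\<kappa> * t) * W t" for t
  have "\<phi> b \<le> \<phi> a + 0 * (b - a)"
  proof (rule Dini_upper_bound[OF ab])
    show "continuous_on {a..b} \<phi>"
      unfolding \<phi>_def by (intro continuous_intros cont)
    fix s \<delta> :: real assume s: "a \<le> s" "s < b" and \<delta>: "0 < \<delta>"
    \<comment> \<open>Near \<open>s\<close> the exponential stays below twice its value at
      \<open>s\<close>, so this slack contributes at most \<open>\<delta> / 2\<close>. The other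
      half is reserved for the difference quotient, whose limit below is 0 because the derivative of
      the factor cancels the decay term.\<close>
    define \<eta> where "\<eta> = \<delta> / (4 * exp (\<kappa> * s))"
    have \<eta>: "0 < \<eta>" using \<delta> by (simp add: \<eta>_def)
    have "((\<lambda>t. exp (\<kappa> * t)) \<longlongrightarrow> exp (\<kappa> * s)) (at_right s)"
      by (intro tendsto_intros)
    then have 1: "\<forall>\<^sub>F t in at_right s. exp (\<kappa> * t) < 2 * exp (\<kappa> * s)"
      by (rule order_tendstoD) simp
    have "((\<lambda>t. exp (\<kappa> * t)) has_real_derivative \<kappa> * exp (\<kappa> * s)) (at s within {s<..})"
      by (auto intro!: derivative_eq_intros)
    then have "((\<lambda>t. (exp (\<kappa> * t) - exp (\<kappa> * s)) / (t - s)) \<longlongrightarrow> \<kappa> * exp (\<kappa> * s)) (at_right s)"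
      by (simp add: has_field_derivative_iff)
    moreover have "((\<lambda>t. exp (\<kappa> * t)) \<longlongrightarrow> exp (\<kappa> * s)) (at_right s)"
      by (intro tendsto_intros)
    ultimately have "((\<lambda>t. (exp (\<kappa> * t) - exp (\<kappa> * s)) / (t - s) * W s - exp (\<kappa> * t) * (\<kappa> * W s))
        \<longlongrightarrow> \<kappa> * exp (\<kappa> * s) * W s - exp (\<kappa> * s) * (\<kappa> * W s)) (at_right s)"
      by (intro tendsto_intros)
    then have 2: "\<forall>\<^sub>F t in at_right s. (exp (\<kappa> * t) - exp (\<kappa> * s)) / (t - s) * W s - exp (\<kappa> * t) * (\<kappa> * W s) < \<delta> / 2"
      by (rule order_tendstoD) (use \<delta> in simp)
    show "\<forall>\<^sub>F t in at_right s. \<phi> t \<le> \<phi> s + (0 + \<delta>) * (t - s)"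
      using slope[OF s \<eta>] 1 2 eventually_at_right_less[of s]
    proof eventually_elim
      case (elim t)
      have "exp (\<kappa> * t) * W t \<le> exp (\<kappa> * t) * (W s + (\<eta> - \<kappa> * W s) * (t - s))"
        using elim(1) by (intro mult_left_mono) auto
      also have "\<dots> = \<phi> s + ((exp (\<kappa> * t) - exp (\<kappa> * s)) / (t - s) * W s - exp (\<kappa> * t) * (\<kappa> * W s)
           + exp (\<kappa> * t) * \<eta>) * (t - s)"
        using elim(4) by (simp add: \<phi>_def field_simps)
      also have "\<dots> \<le> \<phi> s + (\<delta> / 2 + 2 * exp (\<kappa> * s) * \<eta>) * (t - s)"
        using elim \<eta> by (intro add_left_mono mult_right_mono add_mono) auto
      also have "\<dots> = \<phi> s + (0 + \<delta>) * (t - s)"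
        by (simp add: \<eta>_def)
      finally show ?case by (simp add: \<phi>_def)
    qed
  qed
  then have "exp (\<kappa> * b) * W b \<le> exp (\<kappa> * a) * W a" by (simp add: \<phi>_def)
  then have "W b \<le> exp (\<kappa> * a) * W a / exp (\<kappa> * b)"
    by (simp add: field_simps)
  also have "\<dots> = W a * exp (- \<kappa> * (b - a))"
    by (simp add: exp_minus exp_diff field_simps flip: exp_add)
  finally show ?thesis .
qed

subsection \<open>Linearization of piecewise smooth fields\<close>

text \<open>\<open>J\<close> plays the role of the finite set of Jacobians at \<open>x\<close> of the pieces that meet there.
  The estimate holds along an arbitrary curve even if the curve changes pieces infinitely often
  near \<open>s\<close>, because \<open>M\<close> may depend on \<open>t\<close>.\<close>

definition linearized_by :: "('a::real_normed_vector \<Rightarrow> 'b::real_normed_vector) \<Rightarrow> 'a \<Rightarrow> ('a \<Rightarrow>\<^sub>L 'b) set \<Rightarrow> bool" where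
  "linearized_by f x J \<longleftrightarrow> (\<forall>\<epsilon>>0. \<exists>r>0. \<forall>\<gamma> d s \<delta>.
     \<gamma> s \<in> ball x r \<longrightarrow> (\<gamma> has_vector_derivative d) (at_right s) \<longrightarrow> 0 < \<delta> \<longrightarrow>
     (\<forall>\<^sub>F t in at_right s. \<exists>M\<in>J.
        norm (f (\<gamma> t) - f (\<gamma> s) - (t - s) *\<^sub>R blinfun_apply M d) \<le> (\<delta> + \<epsilon> * norm d) * (t - s)))"

lemma has_vector_derivative_right_bound:
  assumes "(\<gamma> has_vector_derivative d) (at_right s)" "0 < \<delta>"
  shows "\<forall>\<^sub>F t in at_right s. norm (\<gamma> t - \<gamma> s - (t - s) *\<^sub>R d) \<le> \<delta> * (t - s)"
proof -
  have "\<forall>\<^sub>F t in at_right s. norm (\<gamma> t - \<gamma> s - (t - s) *\<^sub>R d) \<le> \<delta> * norm (t - s)"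
    using assms unfolding has_vector_derivative_def has_derivative_within_alt2 by auto
  then show ?thesis
    using eventually_at_right_less[of s] by eventually_elim auto
qed

lemma C2_on_imp_C1_on:
  assumes "C2_on g S"
  shows "C1_on g S"
proof -
  obtain g' where g': "\<forall>x\<in>S. (g has_derivative blinfun_apply (g' x)) (at x)" and "C1_on g' S"
    using assms unfolding C2_on_def by blast
  then obtain g'' where "\<forall>x\<in>S. (g' has_derivative blinfun_apply (g'' x)) (at x)"
    unfolding C1_on_def by blast
  then have "continuous_on S g'"
    using continuous_at_imp_continuous_on has_derivative_continuous by blast
  with g' show ?thesis unfolding C1_on_def by blast
qed

lemma piecewise_C2_pieces:
  fixes f :: "'a::euclidean_space \<Rightarrow> 'a"
  assumes "piecewise_C2 f"
  obtains \<D> De g and g' :: "'a set \<Rightarrow> 'a \<Rightarrow> 'a \<Rightarrow>\<^sub>L 'a" where "finite \<D>" "(\<Union>D\<in>\<D>. closure D) = UNIV"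
    "\<And>D. D \<in> \<D> \<Longrightarrow> open D" "\<And>D. D \<in> \<D> \<Longrightarrow> open (De D)" "\<And>D. D \<in> \<D> \<Longrightarrow> closure D \<subseteq> De D"
    "\<And>D x. D \<in> \<D> \<Longrightarrow> x \<in> closure D \<Longrightarrow> f x = g D x"
    "\<And>D x. D \<in> \<D> \<Longrightarrow> x \<in> De D \<Longrightarrow> (g D has_derivative blinfun_apply (g' D x)) (at x)"
    "\<And>D. D \<in> \<D> \<Longrightarrow> continuous_on (De D) (g' D)"
proof -
  obtain \<D> where \<D>: "finite \<D>" "\<forall>D\<in>\<D>. open D" "(\<Union>D\<in>\<D>. closure D) = UNIV"
    and pieces: "\<forall>D\<in>\<D>. \<exists>De g. open De \<and> closure D \<subseteq> De \<and> C2_on g De \<and> (\<forall>x\<in>closure D. f x = g x)"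
    using assms unfolding piecewise_C2_def by (elim conjE exE) (rule that)
  have "\<exists>De g g'. open De \<and> closure D \<subseteq> De \<and> (\<forall>x\<in>closure D. f x = g x) \<and>
      (\<forall>x\<in>De. (g has_derivative blinfun_apply (g' x)) (at x)) \<and> continuous_on De g'" if D: "D \<in> \<D>" for D
  proof -
    obtain De g where "open De" "closure D \<subseteq> De" "C2_on g De" "\<forall>x\<in>closure D. f x = g x"
      using bspec[OF pieces D] by (elim conjE exE) (rule that)
    moreover from C2_on_imp_C1_on[OF this(3)] obtain g' where
      "\<forall>x\<in>De. (g has_derivative blinfun_apply (g' x)) (at x)" "continuous_on De g'"
      unfolding C1_on_def by (elim conjE exE) (rule that)
    ultimately show ?thesis by (intro exI conjI)
  qed
  then obtain De g g' where "\<And>D. D \<in> \<D> \<Longrightarrow> open (De D) \<and> closure D \<subseteq> De D \<and> (\<forall>x\<in>closure D. f x = g D x) \<and>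
      (\<forall>x\<in>De D. (g D has_derivative blinfun_apply (g' D x)) (at x)) \<and> continuous_on (De D) (g' D)"
    by metis
  with \<D> that[of \<D> De g g'] show thesis by blast
qed

text \<open>\<open>J\<close> consists of the derivatives at \<open>x\<close> of the pieces whose
  patch has \<open>x\<close> in its closure. Such a patch is open and \<open>f\<close> inherits the
  derivative of the piece on it, so approaching \<open>x\<close> from inside the patch exhibits the
  matrix as a limit of derivatives of \<open>f\<close>.\<close>

lemma piecewise_C2_linearized_by:
  fixes f :: "'a::euclidean_space \<Rightarrow> 'a"
  assumes "piecewise_C2 f"
  obtains J where "finite J" "linearized_by f x J"
    "\<And>M. M \<in> J \<Longrightarrow> \<exists>X M'. X \<longlonglongrightarrow> x \<and> (\<forall>k. (f has_derivative blinfun_apply (M' k)) (at (X k))) \<and> M' \<longlonglongrightarrow> M"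
proof -
  obtain \<D> De g and g' :: "'a set \<Rightarrow> 'a \<Rightarrow> 'a \<Rightarrow>\<^sub>L 'a" where fin: "finite \<D>" and cover: "(\<Union>D\<in>\<D>. closure D) = UNIV"
    and op: "\<And>D. D \<in> \<D> \<Longrightarrow> open D"
    and De: "\<And>D. D \<in> \<D> \<Longrightarrow> open (De D)" "\<And>D. D \<in> \<D> \<Longrightarrow> closure D \<subseteq> De D"
    and fg: "\<And>D x. D \<in> \<D> \<Longrightarrow> x \<in> closure D \<Longrightarrow> f x = g D x"
    and g': "\<And>D x. D \<in> \<D> \<Longrightarrow> x \<in> De D \<Longrightarrow> (g D has_derivative blinfun_apply (g' D x)) (at x)"
    and cont: "\<And>D. D \<in> \<D> \<Longrightarrow> continuous_on (De D) (g' D)"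
    by (rule piecewise_C2_pieces[OF assms]) (rule that)
  define \<D>' where "\<D>' = {D \<in> \<D>. x \<in> closure D}"
  define J where "J = (\<lambda>D. g' D x) ` \<D>'"
  show thesis
  proof
    show "finite J" using fin by (simp add: J_def \<D>'_def)
  next
    fix M assume "M \<in> J"
    then obtain D where D: "D \<in> \<D>" "x \<in> closure D" "M = g' D x" by (auto simp: J_def \<D>'_def)
    then obtain X where X: "\<And>k. X k \<in> D" "X \<longlonglongrightarrow> x"
      by (auto simp: closure_sequential)
    have sub: "D \<subseteq> De D" using De(2)[OF D(1)] closure_subset by blast
    have "(f has_derivative blinfun_apply (g' D (X k))) (at (X k))" for k
    proof (rule has_derivative_transform_within_open[OF _ op[OF D(1)] X(1)[of k]])
      show "(g D has_derivative blinfun_apply (g' D (X k))) (at (X k))"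
        using g'[OF D(1)] sub X(1) by blast
      show "g D y = f y" if "y \<in> D" for y
        using fg[OF D(1)] closure_subset that by (metis subsetD)
    qed
    moreover have "(\<lambda>k. g' D (X k)) \<longlonglongrightarrow> g' D x"
      using X De(2)[OF D(1)] D(2) sub
      by (intro continuous_on_tendsto_compose[OF cont[OF D(1)]] always_eventually) auto
    ultimately show "\<exists>X M'. X \<longlonglongrightarrow> x \<and> (\<forall>k. (f has_derivative blinfun_apply (M' k)) (at (X k))) \<and> M' \<longlonglongrightarrow> M"
      using X D(3) by (intro exI[of _ X] exI[of _ "\<lambda>k. g' D (X k)"]) auto
  next
    show "linearized_by f x J"
      unfolding linearized_by_def
    proof (intro allI impI)
      fix \<epsilon> :: real assume \<epsilon>: "0 < \<epsilon>"
      \<comment> \<open>A small ball misses the closures that do not contain \<open>x\<close>; for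
        the others, continuity keeps the derivative of the piece within \<open>\<epsilon>\<close> of
        its value at \<open>x\<close>.\<close>
      have "\<exists>r>0. \<forall>y\<in>ball x r \<inter> closure D. D \<in> \<D>' \<and> norm (g' D y - g' D x) \<le> \<epsilon>" if D: "D \<in> \<D>" for D
      proof (cases "x \<in> closure D")
        case True
        then have "continuous (at x) (g' D)"
          using cont[OF D] De[OF D] by (auto simp: continuous_on_eq_continuous_at)
        then obtain r where "0 < r" "\<And>y. dist y x < r \<Longrightarrow> dist (g' D y) (g' D x) < \<epsilon>"
          using \<epsilon> unfolding continuous_within_eps_delta by (metis UNIV_I)
        with True D show ?thesis
          by (intro exI[of _ r]) (auto simp: \<D>'_def dist_norm norm_minus_commute intro!: less_imp_le)
      next
        case False
        then obtain r where "0 < r" "ball x r \<subseteq> - closure D"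
          using open_contains_ball[of "- closure D"] by auto
        then show ?thesis by blast
      qed
      then obtain r where r: "\<And>D. D \<in> \<D> \<Longrightarrow> 0 < r D"
        "\<And>D y. D \<in> \<D> \<Longrightarrow> y \<in> ball x (r D) \<Longrightarrow> y \<in> closure D \<Longrightarrow> D \<in> \<D>' \<and> norm (g' D y - g' D x) \<le> \<epsilon>"
        by (metis IntI)
      define R where "R = Min (insert 1 (r ` \<D>))"
      have R: "0 < R" "\<And>D. D \<in> \<D> \<Longrightarrow> R \<le> r D"
        using fin r(1) by (auto simp: R_def)
      show "\<exists>r>0. \<forall>\<gamma> d s \<delta>. \<gamma> s \<in> ball x r \<longrightarrow> (\<gamma> has_vector_derivative d) (at_right s) \<longrightarrow> 0 < \<delta> \<longrightarrow>
        (\<forall>\<^sub>F t in at_right s. \<exists>M\<in>J.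
          norm (f (\<gamma> t) - f (\<gamma> s) - (t - s) *\<^sub>R blinfun_apply M d) \<le> (\<delta> + \<epsilon> * norm d) * (t - s))"
      proof (intro exI[of _ R] conjI R(1) allI impI)
        fix \<gamma> :: "real \<Rightarrow> 'a" and d s and \<delta> :: real
        assume \<gamma>s: "\<gamma> s \<in> ball x R" and \<gamma>': "(\<gamma> has_vector_derivative d) (at_right s)" and \<delta>: "0 < \<delta>"
        have \<gamma>lim: "(\<gamma> \<longlongrightarrow> \<gamma> s) (at_right s)"
          using has_vector_derivative_continuous[OF \<gamma>'] by (simp add: continuous_within)
        \<comment> \<open>One patch at a time: if its closure misses \<open>\<gamma> s\<close>, the
          curve stays off it for \<open>t\<close> close to \<open>s\<close>. Otherwise
          \<open>f\<close> equals \<open>g D\<close> at both \<open>\<gamma> s\<close> and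
          \<open>\<gamma> t\<close>, and the chain rule for \<open>g D \<circ> \<gamma>\<close>
          applies; the curve between the two times is irrelevant.\<close>
        have "\<forall>\<^sub>F t in at_right s. \<gamma> t \<in> closure D \<longrightarrow> (\<exists>M\<in>J.
          norm (f (\<gamma> t) - f (\<gamma> s) - (t - s) *\<^sub>R blinfun_apply M d) \<le> (\<delta> + \<epsilon> * norm d) * (t - s))"
          if D: "D \<in> \<D>" for D
        proof (cases "\<gamma> s \<in> closure D")
          case False
          then have "\<forall>\<^sub>F t in at_right s. \<gamma> t \<in> - closure D"
            using topological_tendstoD[OF \<gamma>lim, of "- closure D"] by auto
          then show ?thesis by eventually_elim auto
        next
          case True
          then have D': "D \<in> \<D>'" "norm (g' D (\<gamma> s) - g' D x) \<le> \<epsilon>"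
            using r(2)[OF D, of "\<gamma> s"] \<gamma>s R(2)[OF D] by auto
          have "(g D has_derivative blinfun_apply (g' D (\<gamma> s))) (at (\<gamma> s) within \<gamma> ` {s<..})"
            using g'[OF D] De(2)[OF D] True has_derivative_at_withinI by blast
          then have "((g D \<circ> \<gamma>) has_vector_derivative blinfun_apply (g' D (\<gamma> s)) d) (at_right s)"
            using diff_chain_within[OF \<gamma>'[unfolded has_vector_derivative_def]]
            unfolding has_vector_derivative_def by (fastforce simp: o_def blinfun.scaleR_right)
          from has_vector_derivative_right_bound[OF this \<delta>]
          show ?thesis using eventually_at_right_less[of s]
          proof eventually_elim
            case (elim t)
            show ?case
            proof (intro impI bexI[of _ "g' D x"])
              assume "\<gamma> t \<in> closure D"
              have "norm (f (\<gamma> t) - f (\<gamma> s) - (t - s) *\<^sub>R blinfun_apply (g' D x) d)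
                = norm ((g D (\<gamma> t) - g D (\<gamma> s) - (t - s) *\<^sub>R blinfun_apply (g' D (\<gamma> s)) d)
                   + (t - s) *\<^sub>R blinfun_apply (g' D (\<gamma> s) - g' D x) d)"
                using fg[OF D True] fg[OF D \<open>\<gamma> t \<in> closure D\<close>]
                by (simp add: blinfun.diff_left algebra_simps)
              also have "\<dots> \<le> \<delta> * (t - s) + (t - s) * (\<epsilon> * norm d)"
              proof (rule order_trans[OF norm_triangle_ineq] , rule add_mono)
                have "norm (blinfun_apply (g' D (\<gamma> s) - g' D x) d) \<le> \<epsilon> * norm d"
                  using norm_blinfun[of "g' D (\<gamma> s) - g' D x" d] D'(2)
                  by (meson mult_right_mono norm_ge_zero order_trans)
                then show "norm ((t - s) *\<^sub>R blinfun_apply (g' D (\<gamma> s) - g' D x) d) \<le> (t - s) * (\<epsilon> * norm d)"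
                  using elim(2) by simp
              qed (use elim(1) in simp)
              finally show "norm (f (\<gamma> t) - f (\<gamma> s) - (t - s) *\<^sub>R blinfun_apply (g' D x) d) \<le> (\<delta> + \<epsilon> * norm d) * (t - s)"
                by (simp add: algebra_simps)
            qed (use D'(1) in \<open>simp add: J_def\<close>)
          qed
        qed
        then have "\<forall>\<^sub>F t in at_right s. \<forall>D\<in>\<D>. \<gamma> t \<in> closure D \<longrightarrow> (\<exists>M\<in>J.
          norm (f (\<gamma> t) - f (\<gamma> s) - (t - s) *\<^sub>R blinfun_apply M d) \<le> (\<delta> + \<epsilon> * norm d) * (t - s))"
          using fin by (intro eventually_ball_finite) auto
        then show "\<forall>\<^sub>F t in at_right s. \<exists>M\<in>J.
          norm (f (\<gamma> t) - f (\<gamma> s) - (t - s) *\<^sub>R blinfun_apply M d) \<le> (\<delta> + \<epsilon> * norm d) * (t - s)"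
        proof eventually_elim
          case (elim t)
          have "\<gamma> t \<in> (\<Union>D\<in>\<D>. closure D)" using cover by simp
          with elim show ?case by blast
        qed
      qed
    qed
  qed
qed

subsection \<open>Common quadratic Lyapunov forms\<close>

text \<open>\<open>P\<close> is only positive semidefinite: its kernel plays the role of the tangent space of \<open>E\<close>.\<close>

definition lyapunov_for :: "('a::euclidean_space \<Rightarrow> 'a) \<Rightarrow> ('a \<Rightarrow>\<^sub>L 'a) set \<Rightarrow> bool" where
  "lyapunov_for P J \<longleftrightarrow> linear P \<and> (\<forall>x y. P x \<bullet> y = x \<bullet> P y) \<and> (\<forall>x. P x \<noteq> 0 \<longrightarrow> 0 < x \<bullet> P x) \<and>
     (\<forall>M\<in>J. \<forall>x. (P x \<noteq> 0 \<longrightarrow> P x \<bullet> blinfun_apply M x < 0) \<and> (P x = 0 \<longrightarrow> P (blinfun_apply M x) = 0))"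

text \<open>Compactness of the unit sphere of \<open>S\<close> makes positivity uniform. The case
  split is needed because that sphere is empty when \<open>S\<close> is trivial.\<close>

lemma homogeneous_lower_bound:
  fixes q :: "'a::euclidean_space \<Rightarrow> real"
  assumes S: "subspace S" and cont: "continuous_on UNIV q"
    and hom: "\<And>c x. q (c *\<^sub>R x) = c\<^sup>2 * q x"
    and pos: "\<And>x. x \<in> S \<Longrightarrow> x \<noteq> 0 \<Longrightarrow> 0 < q x"
  shows "\<exists>c>0. \<forall>x\<in>S. c * (norm x)\<^sup>2 \<le> q x"
proof (cases "sphere 0 1 \<inter> S = {}")
  case True
  have "x = 0" if "x \<in> S" for x
  proof (rule ccontr)
    assume "x \<noteq> 0"
    then have "(1 / norm x) *\<^sub>R x \<in> sphere 0 1 \<inter> S"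
      using that S by (simp add: subspace_scale)
    with True show False by blast
  qed
  moreover have "q 0 = 0" using hom[of 0 0] by simp
  ultimately show ?thesis by (intro exI[of _ 1]) fastforce
next
  case False
  have "compact (sphere 0 1 \<inter> S)"
    using S by (simp add: closed_subspace compact_Int_closed)
  then obtain u where u: "u \<in> sphere 0 1 \<inter> S" "\<And>x. x \<in> sphere 0 1 \<inter> S \<Longrightarrow> q u \<le> q x"
    using continuous_attains_inf[OF _ False continuous_on_subset[OF cont]] by blast
  have "q u * (norm x)\<^sup>2 \<le> q x" if "x \<in> S" for x
  proof (cases "x = 0")
    case True
    then show ?thesis using hom[of 0 0] by simp
  next
    case False
    then have "q u \<le> q ((1 / norm x) *\<^sub>R x)"
      using that S by (intro u) (simp add: subspace_scale)
    also have "\<dots> = q x / (norm x)\<^sup>2" by (simp add: hom power_divide)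
    finally show ?thesis using False by (simp add: field_simps)
  qed
  moreover have "0 < q u" using u(1) by (intro pos) auto
  ultimately show ?thesis by blast
qed

text \<open>Both sides are unchanged when a kernel vector of \<open>P\<close> is added, so it
  suffices to compare them on the orthogonal complement of the kernel. There \<open>q\<close> is
  positive definite and \<open>norm (P w)\<close> is at most a multiple of
  \<open>norm w\<close>.\<close>

lemma homogeneous_lower_bound_off_kernel:
  fixes q :: "'a::euclidean_space \<Rightarrow> real" and P :: "'a \<Rightarrow> 'b::euclidean_space"
  assumes P: "linear P" and cont: "continuous_on UNIV q"
    and hom: "\<And>c x. q (c *\<^sub>R x) = c\<^sup>2 * q x"
    and inv: "\<And>k w. P k = 0 \<Longrightarrow> q (k + w) = q w"
    and pos: "\<And>x. P x \<noteq> 0 \<Longrightarrow> 0 < q x"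
  shows "\<exists>c>0. \<forall>x. c * (norm (P x))\<^sup>2 \<le> q x"
proof -
  interpret P: linear P by fact
  define K where "K = {x. P x = 0}"
  define S where "S = {w. \<forall>k\<in>K. w \<bullet> k = 0}"
  have K: "subspace K" unfolding K_def by (simp add: subspace_def P.add P.scaleR P.zero)
  have S: "subspace S" unfolding S_def
    by (auto simp: subspace_def inner_add_left)
  have "0 < q w" if "w \<in> S" "w \<noteq> 0" for w
  proof -
    have "P w \<noteq> 0" using that by (force simp: S_def K_def)
    then show ?thesis by (rule pos)
  qed
  then obtain c where c: "0 < c" "\<And>w. w \<in> S \<Longrightarrow> c * (norm w)\<^sup>2 \<le> q w"
    using homogeneous_lower_bound[OF S cont hom] by blast
  obtain B where B: "0 < B" "\<And>x. norm (P x) \<le> B * norm x"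
    using linear_bounded_pos[OF P] by blast
  have "c / B\<^sup>2 * (norm (P x))\<^sup>2 \<le> q x" for x
  proof -
    obtain k w where kw: "k \<in> K" "\<And>v. v \<in> K \<Longrightarrow> w \<bullet> v = 0" "x = k + w"
      using orthogonal_subspace_decomp_exists[of K x] span_eq_iff[THEN iffD2, OF K]
      unfolding Linear_Algebra.orthogonal_def by metis
    then have "w \<in> S" "P x = P w" "q x = q w"
      using inv by (auto simp: S_def K_def P.add)
    moreover have "(norm (P w))\<^sup>2 \<le> B\<^sup>2 * (norm w)\<^sup>2"
      using power_mono[OF B(2)[of w], of 2] by (simp add: power_mult_distrib)
    then have "c * (norm (P w))\<^sup>2 \<le> B\<^sup>2 * (c * (norm w)\<^sup>2)"
      using c(1) by (simp add: mult.left_commute)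
    then have "c / B\<^sup>2 * (norm (P w))\<^sup>2 \<le> c * (norm w)\<^sup>2"
      using B(1) by (simp add: field_simps)
    ultimately show ?thesis using c(2)[of w] by simp
  qed
  moreover have "0 < c / B\<^sup>2" using c(1) B(1) by simp
  ultimately show ?thesis by blast
qed

text \<open>One constant for three quadratic forms, all measured by \<open>norm (P x)\<close>
  because \<open>P\<close> is degenerate. The last bound says that \<open>P\<close> is bounded below
  on its own range.\<close>

lemma lyapunov_for_bounds:
  assumes L: "lyapunov_for P J" and fin: "finite J"
  obtains c where "0 < c" "\<And>x. c * (norm (P x))\<^sup>2 \<le> x \<bullet> P x"
    "\<And>M x. M \<in> J \<Longrightarrow> P x \<bullet> blinfun_apply M x \<le> - c * (norm (P x))\<^sup>2"
    "\<And>x. c * norm (P x) \<le> norm (P (P x))"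
proof -
  have P: "linear P" and sym: "\<And>x y. P x \<bullet> y = x \<bullet> P y"
    and pos: "\<And>x. P x \<noteq> 0 \<Longrightarrow> 0 < x \<bullet> P x"
    and neg: "\<And>M x. M \<in> J \<Longrightarrow> P x \<noteq> 0 \<Longrightarrow> P x \<bullet> blinfun_apply M x < 0"
    and ker: "\<And>M x. M \<in> J \<Longrightarrow> P x = 0 \<Longrightarrow> P (blinfun_apply M x) = 0"
    using L unfolding lyapunov_for_def by blast+
  interpret P: linear P by fact
  have contP: "continuous_on UNIV P"
    using P by (simp add: linear_continuous_on linear_conv_bounded_linear)
  have "\<exists>c>0. \<forall>x. c * (norm (P x))\<^sup>2 \<le> x \<bullet> P x"
    using sym pos by (intro homogeneous_lower_bound_off_kernel[OF P])
      (auto intro!: continuous_intros contP simp: P.scaleR P.add power2_eq_square inner_add_left simp flip: sym)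
  then obtain a where a: "0 < a" "\<And>x. a * (norm (P x))\<^sup>2 \<le> x \<bullet> P x" by blast
  \<comment> \<open>By symmetry \<open>x \<bullet> P (P x)\<close> is the squared norm of
    \<open>P x\<close>: kernel and range of \<open>P\<close> meet only in 0.\<close>
  have PP: "P (P x) \<noteq> 0" if "P x \<noteq> 0" for x
    using that sym[of x "P x"] by auto
  have "\<exists>c>0. \<forall>x. c * (norm (P x))\<^sup>2 \<le> (norm (P (P x)))\<^sup>2"
    using PP by (intro homogeneous_lower_bound_off_kernel[OF P])
      (auto intro!: continuous_intros continuous_on_compose2[OF contP contP] simp: P.scaleR P.add power_mult_distrib)
  then obtain b where b: "0 < b" "\<And>x. b * (norm (P x))\<^sup>2 \<le> (norm (P (P x)))\<^sup>2" by blast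
  have "\<forall>M\<in>J. \<exists>c>0. \<forall>x. c * (norm (P x))\<^sup>2 \<le> - (P x \<bullet> blinfun_apply M x)"
  proof
    fix M assume M: "M \<in> J"
    show "\<exists>c>0. \<forall>x. c * (norm (P x))\<^sup>2 \<le> - (P x \<bullet> blinfun_apply M x)"
    proof (rule homogeneous_lower_bound_off_kernel[OF P])
      show "continuous_on UNIV (\<lambda>x. - (P x \<bullet> blinfun_apply M x))"
        by (intro continuous_intros contP)
      show "- (P (c *\<^sub>R x) \<bullet> blinfun_apply M (c *\<^sub>R x)) = c\<^sup>2 * - (P x \<bullet> blinfun_apply M x)" for c x
        by (simp add: P.scaleR blinfun.scaleR_right power2_eq_square)
      \<comment> \<open>The cross term \<open>P w \<bullet> M k\<close> equals
        \<open>w \<bullet> P (M k)\<close>, which vanishes because \<open>M\<close> maps the kernel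
        of \<open>P\<close> into itself.\<close>
      show "- (P (k + w) \<bullet> blinfun_apply M (k + w)) = - (P w \<bullet> blinfun_apply M w)" if "P k = 0" for k w
        using ker[OF M that] that by (simp add: P.add blinfun.add_right inner_add_right sym[of w "blinfun_apply M k"])
    qed (use neg[OF M] in simp)
  qed
  then obtain e where e: "\<And>M. M \<in> J \<Longrightarrow> 0 < e M"
    "\<And>M x. M \<in> J \<Longrightarrow> e M * (norm (P x))\<^sup>2 \<le> - (P x \<bullet> blinfun_apply M x)"
    by metis
  \<comment> \<open>The square root of \<open>b\<close> appears because \<open>b\<close> compares
    squared norms.\<close>
  define c where "c = Min (insert a (insert (sqrt b) (e ` J)))"
  have "finite (insert a (insert (sqrt b) (e ` J)))" using fin by simp
  then have c: "0 < c" "c \<le> a" "c \<le> sqrt b" "\<And>M. M \<in> J \<Longrightarrow> c \<le> e M"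
    using a(1) b(1) e(1) Min_le by (auto simp: c_def simp del: Min_insert)
  show thesis
  proof
    show "0 < c" by fact
    show "c * (norm (P x))\<^sup>2 \<le> x \<bullet> P x" for x
      using a(2)[of x] c(2) by (meson mult_right_mono order_trans zero_le_power2)
    show "P x \<bullet> blinfun_apply M x \<le> - c * (norm (P x))\<^sup>2" if "M \<in> J" for M x
      using e(2)[OF that, of x] mult_right_mono[OF c(4)[OF that], of "(norm (P x))\<^sup>2"] by simp
    show "c * norm (P x) \<le> norm (P (P x))" for x
    proof -
      have "c * norm (P x) \<le> sqrt b * norm (P x)" using c(3) by (rule mult_right_mono) simp
      also have "\<dots> = sqrt (b * (norm (P x))\<^sup>2)" by (simp add: real_sqrt_mult)
      also have "\<dots> \<le> norm (P (P x))" using b(2)[of x] by (intro real_le_lsqrt) auto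
      finally show ?thesis .
    qed
  qed
qed

text \<open>Since \<open>f\<close> vanishes along the curve, linearization forces some
  \<open>M\<close> in \<open>J\<close> to nearly annihilate \<open>d\<close>. The Lyapunov
  inequality forbids this unless \<open>P d\<close> is 0. Applied to curves in \<open>E\<close>, it
  places tangent vectors in the kernel of \<open>P\<close>.\<close>

lemma tangent_of_zero_set_in_kernel:
  assumes L: "lyapunov_for P J" and fin: "finite J" and lin: "linearized_by f x J" and "f x = 0"
    and \<gamma>: "\<gamma> s = x" "(\<gamma> has_vector_derivative d) (at_right s)" "\<forall>\<^sub>F t in at_right s. f (\<gamma> t) = 0"
  shows "P d = 0"
proof (rule ccontr)
  assume Pd: "P d \<noteq> 0"
  obtain c where c: "0 < c" "\<And>M x. M \<in> J \<Longrightarrow> P x \<bullet> blinfun_apply M x \<le> - c * (norm (P x))\<^sup>2"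
    by (rule lyapunov_for_bounds[OF L fin]) (rule that)
  \<comment> \<open>With \<open>norm (M d)\<close> at most \<open>2 * \<delta>\<close>, this value
    makes \<open>- (P d \<bullet> M d)\<close> at most half of its lower bound
    \<open>c * (norm (P d))\<^sup>2\<close>.\<close>
  define \<delta> where "\<delta> = c * norm (P d) / 4"
  define \<epsilon> where "\<epsilon> = \<delta> / (norm d + 1)"
  have \<delta>: "0 < \<delta>" using Pd c(1) by (simp add: \<delta>_def)
  then have \<epsilon>: "0 < \<epsilon>" unfolding \<epsilon>_def by (intro divide_pos_pos) (auto intro: add_nonneg_pos)
  have "\<epsilon> * norm d \<le> \<epsilon> * (norm d + 1)" using \<epsilon> by (intro mult_left_mono) auto
  also have "\<dots> = \<delta>" unfolding \<epsilon>_def by (simp add: add_nonneg_eq_0_iff)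
  finally have \<epsilon>d: "\<epsilon> * norm d \<le> \<delta>" .
  obtain r where r: "0 < r" "\<And>\<gamma> d s \<delta>. \<gamma> s \<in> ball x r \<Longrightarrow> (\<gamma> has_vector_derivative d) (at_right s) \<Longrightarrow> 0 < \<delta> \<Longrightarrow>
     (\<forall>\<^sub>F t in at_right s. \<exists>M\<in>J.
        norm (f (\<gamma> t) - f (\<gamma> s) - (t - s) *\<^sub>R blinfun_apply M d) \<le> (\<delta> + \<epsilon> * norm d) * (t - s))"
    using lin \<epsilon> unfolding linearized_by_def by blast
  have \<gamma>s: "\<gamma> s \<in> ball x r" using \<gamma>(1) r(1) by simp
  have "\<forall>\<^sub>F t in at_right s. \<exists>M\<in>J. norm (blinfun_apply M d) \<le> 2 * \<delta>"
    using r(2)[of \<gamma>, OF \<gamma>s \<gamma>(2) \<delta>] \<gamma>(3) eventually_at_right_less[of s]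
  proof eventually_elim
    case (elim t)
    then obtain M where M: "M \<in> J" "norm (0 - (t - s) *\<^sub>R blinfun_apply M d) \<le> (\<delta> + \<epsilon> * norm d) * (t - s)"
      using \<open>f x = 0\<close> \<gamma>(1) by auto
    then have "(t - s) * norm (blinfun_apply M d) \<le> (t - s) * (\<delta> + \<epsilon> * norm d)"
      using elim by (simp add: mult.commute)
    then have "norm (blinfun_apply M d) \<le> \<delta> + \<epsilon> * norm d"
      using elim by simp
    with M(1) \<epsilon>d show ?case by (intro bexI[of _ M]) auto
  qed
  then obtain M where M: "M \<in> J" "norm (blinfun_apply M d) \<le> 2 * \<delta>"
    using eventually_happens'[OF trivial_limit_at_right_real] by blast
  have "c * (norm (P d))\<^sup>2 \<le> - (P d \<bullet> blinfun_apply M d)" using c(2)[OF M(1), of d] by simp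
  also have "\<dots> \<le> norm (P d) * norm (blinfun_apply M d)"
    using Cauchy_Schwarz_ineq2[of "P d" "blinfun_apply M d"] by linarith
  also have "\<dots> \<le> norm (P d) * (2 * \<delta>)" using M(2) by (intro mult_left_mono) auto
  also have "\<dots> = c * (norm (P d))\<^sup>2 / 2" by (simp add: \<delta>_def power2_eq_square)
  finally show False using c(1) Pd by simp
qed

text \<open>Along the segment from \<open>z\<close> to \<open>y\<close>, with
  \<open>d = y - z\<close>, the scalar \<open>P d \<bullet> f\<close> starts at 0 and falls with
  slope at most a negative multiple of the squared norm of \<open>P d\<close>. Since
  \<open>d\<close> lies in the range of \<open>P\<close>, \<open>norm (P d)\<close> is at least
  \<open>c * norm d\<close>, so \<open>P (f y)\<close> cannot be small compared with
  \<open>d\<close>.\<close>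

lemma zero_set_error_bound:
  assumes L: "lyapunov_for P J" and fin: "finite J" and lin: "linearized_by f x J" and cont: "continuous_on UNIV f"
  obtains r C where "0 < r" "0 < C"
    "\<And>y z w. y \<in> ball x r \<Longrightarrow> z \<in> ball x r \<Longrightarrow> f z = 0 \<Longrightarrow> y = z + P w \<Longrightarrow> norm (y - z) \<le> C * norm (P (f y))"
proof -
  obtain c where c: "0 < c" "\<And>M x. M \<in> J \<Longrightarrow> P x \<bullet> blinfun_apply M x \<le> - c * (norm (P x))\<^sup>2"
     "\<And>x. c * norm (P x) \<le> norm (P (P x))"
    by (rule lyapunov_for_bounds[OF L fin]) (rule that)
  have sym: "P x \<bullet> y = x \<bullet> P y" for x y using L by (simp add: lyapunov_for_def)
  \<comment> \<open>Together with \<open>c * norm d \<le> norm (P d)\<close> this bounds the error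
    \<open>\<epsilon> * norm d\<close> by \<open>c / 2 * norm (P d)\<close>, half of the
    dissipation. The remaining half, and \<open>c * norm d \<le> norm (P d)\<close> used twice more,
    produce the constant \<open>2 / c ^ 3\<close>.\<close>
  define \<epsilon> where "\<epsilon> = c\<^sup>2 / 2"
  have \<epsilon>: "0 < \<epsilon>" using c(1) by (simp add: \<epsilon>_def)
  obtain r where r: "0 < r" "\<And>\<gamma> d s \<delta>. \<gamma> s \<in> ball x r \<Longrightarrow> (\<gamma> has_vector_derivative d) (at_right s) \<Longrightarrow> 0 < \<delta> \<Longrightarrow>
     (\<forall>\<^sub>F t in at_right s. \<exists>M\<in>J.
        norm (f (\<gamma> t) - f (\<gamma> s) - (t - s) *\<^sub>R blinfun_apply M d) \<le> (\<delta> + \<epsilon> * norm d) * (t - s))"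
    using lin \<epsilon> unfolding linearized_by_def by blast
  show thesis
  proof
    show "0 < r" by fact
    show "0 < 2 / c ^ 3" using c(1) by simp
    fix y z w assume y: "y \<in> ball x r" and z: "z \<in> ball x r" and fz: "f z = 0" and yz: "y = z + P w"
    define d where "d = y - z"
    define \<gamma> where "\<gamma> s = z + s *\<^sub>R d" for s :: real
    have d: "c * norm d \<le> norm (P d)" using c(3)[of w] yz by (simp add: d_def)
    have \<gamma>r: "\<gamma> s \<in> ball x r" if "0 \<le> s" "s \<le> 1" for s
    proof -
      have "\<gamma> s = (1 - s) *\<^sub>R z + s *\<^sub>R y" by (simp add: \<gamma>_def d_def algebra_simps)
      then show ?thesis using that y z convexD_alt[OF convex_ball, of z x r y s] by (simp add: add.commute)
    qed
    have \<gamma>': "(\<gamma> has_vector_derivative d) (at_right s)" for s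
      unfolding \<gamma>_def by (auto intro!: derivative_eq_intros)
    define m where "m = - c * (norm (P d))\<^sup>2 + norm (P d) * (\<epsilon> * norm d)"
    have "P d \<bullet> f (\<gamma> 1) \<le> P d \<bullet> f (\<gamma> 0) + m * (1 - 0)"
    proof (rule Dini_upper_bound)
      show "continuous_on {0..1} (\<lambda>s. P d \<bullet> f (\<gamma> s))"
        unfolding \<gamma>_def by (intro continuous_intros continuous_on_compose2[OF cont]) auto
      fix s \<delta> :: real assume s: "0 \<le> s" "s < 1" and \<delta>: "0 < \<delta>"
      define \<eta> where "\<eta> = \<delta> / (norm (P d) + 1)"
      have n: "0 < norm (P d) + 1" by (intro add_nonneg_pos) auto
      have \<eta>: "0 < \<eta>" using \<delta> n by (simp add: \<eta>_def)
      have "norm (P d) * \<eta> \<le> (norm (P d) + 1) * \<eta>" using \<eta> by (intro mult_right_mono) auto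
      then have \<eta>\<delta>: "norm (P d) * \<eta> \<le> \<delta>" using n by (simp add: \<eta>_def)
      show "\<forall>\<^sub>F t in at_right s. P d \<bullet> f (\<gamma> t) \<le> P d \<bullet> f (\<gamma> s) + (m + \<delta>) * (t - s)"
        using r(2)[of \<gamma>, OF \<gamma>r[OF s(1) less_imp_le[OF s(2)]] \<gamma>' \<eta>] eventually_at_right_less[of s]
      proof eventually_elim
        case (elim t)
        then obtain M where M: "M \<in> J"
          "norm (f (\<gamma> t) - f (\<gamma> s) - (t - s) *\<^sub>R blinfun_apply M d) \<le> (\<eta> + \<epsilon> * norm d) * (t - s)"
          by blast
        have "P d \<bullet> f (\<gamma> t) - P d \<bullet> f (\<gamma> s)
          = (t - s) * (P d \<bullet> blinfun_apply M d) + P d \<bullet> (f (\<gamma> t) - f (\<gamma> s) - (t - s) *\<^sub>R blinfun_apply M d)"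
          by (simp add: inner_diff_right)
        also have "\<dots> \<le> (t - s) * (- c * (norm (P d))\<^sup>2) + norm (P d) * ((\<eta> + \<epsilon> * norm d) * (t - s))"
          using elim(2) by (intro add_mono mult_left_mono c(2)[OF M(1)] order_trans[OF norm_cauchy_schwarz] M(2)) auto
        also have "\<dots> = (t - s) * (m + norm (P d) * \<eta>)" by (simp add: m_def algebra_simps)
        also have "\<dots> \<le> (t - s) * (m + \<delta>)" using elim \<eta>\<delta> by (intro mult_left_mono) auto
        finally show ?case by (simp add: algebra_simps)
      qed
    qed simp
    then have "P d \<bullet> f y \<le> m" by (simp add: \<gamma>_def d_def fz)
    moreover have "norm (P d) * (\<epsilon> * norm d) \<le> norm (P d) * (c / 2 * norm (P d))"
    proof (rule mult_left_mono)
      have "\<epsilon> * norm d = c / 2 * (c * norm d)" by (simp add: \<epsilon>_def power2_eq_square)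
      also have "\<dots> \<le> c / 2 * norm (P d)" using d c(1) by (intro mult_left_mono) auto
      finally show "\<epsilon> * norm d \<le> c / 2 * norm (P d)" .
    qed simp
    ultimately have "c / 2 * (norm (P d))\<^sup>2 \<le> - (P d \<bullet> f y)"
      by (simp add: m_def power2_eq_square field_simps)
    also have "\<dots> \<le> norm d * norm (P (f y))"
      using Cauchy_Schwarz_ineq2[of d "P (f y)"] by (simp add: sym)
    finally have 1: "c / 2 * (norm (P d))\<^sup>2 \<le> norm d * norm (P (f y))" .
    show "norm (y - z) \<le> 2 / c ^ 3 * norm (P (f y))"
    proof (cases "d = 0")
      case False
      have "c / 2 * (c * norm d)\<^sup>2 \<le> c / 2 * (norm (P d))\<^sup>2"
        using d c(1) by (intro mult_left_mono power_mono) auto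
      with 1 have "norm d * (c ^ 3 / 2 * norm d) \<le> norm d * norm (P (f y))"
        by (simp add: power2_eq_square power3_eq_cube mult_ac)
      then have "c ^ 3 / 2 * norm d \<le> norm (P (f y))" using False by simp
      then show ?thesis using c(1) by (simp add: d_def field_simps)
    qed (use c(1) in \<open>simp add: d_def\<close>)
  qed
qed

subsection \<open>The zero set as a graph over its tangent space\<close>

lemma orthogonal_projection_exists:
  fixes S :: "'a::euclidean_space set"
  assumes S: "subspace S"
  obtains \<pi> :: "'a \<Rightarrow> 'a" where "linear \<pi>" "\<And>x. \<pi> x \<in> S" "\<And>x. x \<in> S \<Longrightarrow> \<pi> x = x"
proof -
  obtain B where B: "B \<subseteq> S" "pairwise Linear_Algebra.orthogonal B" "\<And>x. x \<in> B \<Longrightarrow> norm x = 1"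
    "independent B" "span B = S"
    using orthonormal_basis_subspace[OF S] by metis
  then have fin: "finite B" by (simp add: independent_imp_finite)
  define \<pi> where "\<pi> x = (\<Sum>b\<in>B. (x \<bullet> b) *\<^sub>R b)" for x
  show thesis
  proof
    show "linear \<pi>"
      by (rule linearI) (simp_all add: \<pi>_def inner_add_left scaleR_add_left sum.distrib scaleR_sum_right)
    show "\<pi> x \<in> S" for x
      unfolding \<pi>_def using B(1) S by (intro subspace_sum subspace_scale) auto
    show "\<pi> x = x" if "x \<in> S" for x
      unfolding \<pi>_def using that B fin by (intro orthonormal_basis_expand) auto
  qed
qed

text \<open>A substitute for a tubular neighbourhood: points near \<open>x\<close> are reached from
  \<open>E\<close> along the fixed direction space \<open>range P\<close>. The zero-set bound needs
  exactly such displacements.\<close>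

lemma submanifold_transversal:
  fixes f :: "'a::euclidean_space \<Rightarrow> 'a"
  assumes mfd: "submanifold p E" and x: "x \<in> E" and zero: "\<And>y. y \<in> E \<Longrightarrow> f y = 0"
    and L: "lyapunov_for P J" and fin: "finite J" and lin: "linearized_by f x J"
    and dimP: "dim {y. P y = 0} \<le> p" and r: "0 < r"
  obtains \<rho> where "0 < \<rho>" "\<And>y. y \<in> ball x \<rho> \<Longrightarrow> \<exists>z\<in>E \<inter> ball x r. \<exists>w. y = z + P w"
proof -
  have P: "linear P" and sym: "\<And>x y. P x \<bullet> y = x \<bullet> P y"
    using L unfolding lyapunov_for_def by blast+
  interpret P: linear P by fact
  obtain U V \<phi> \<psi> and S :: "'a set" where U: "open U" "x \<in> U" and V: "open V"
    and hom: "homeomorphism U V \<phi> \<psi>" and C1: "C1_on \<phi> U" "C1_on \<psi> V"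
    and S: "subspace S" "dim S = p" and img: "\<phi> ` (E \<inter> U) = S \<inter> V"
    using bspec[OF mfd[unfolded submanifold_def] x] by (elim exE conjE) (rule that)
  define y0 where "y0 = \<phi> x"
  have y0: "y0 \<in> S" "y0 \<in> V" "\<psi> y0 = x"
    using img x U(2) hom by (auto simp: y0_def homeomorphism_def)
  have \<psi>E: "\<psi> v \<in> E" if "v \<in> S" "v \<in> V" for v
  proof -
    have "v \<in> \<phi> ` (E \<inter> U)" using that by (simp add: img)
    then obtain e where "e \<in> E" "e \<in> U" "v = \<phi> e" by blast
    then show ?thesis using hom by (simp add: homeomorphism_def)
  qed
  have cont\<psi>: "continuous_on V \<psi>" using hom by (simp add: homeomorphism_def)
  have "\<exists>\<psi>'. (\<psi> has_derivative blinfun_apply \<psi>') (at y0)"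
    using C1(2) y0(2) unfolding C1_on_def by fast
  then obtain \<psi>' where \<psi>': "(\<psi> has_derivative blinfun_apply \<psi>') (at y0)" ..
  have "\<exists>\<phi>'. (\<phi> has_derivative blinfun_apply \<phi>') (at (\<psi> y0))"
    using C1(1) U(2) unfolding C1_on_def y0(3) by fast
  then obtain \<phi>' where "(\<phi> has_derivative blinfun_apply \<phi>') (at (\<psi> y0))" ..
  \<comment> \<open>Differentiating \<open>\<phi> \<circ> \<psi> = id\<close> gives a left inverse
    of \<open>\<psi>'\<close>, hence injectivity.\<close>
  from diff_chain_at[OF \<psi>' this]
  have "(\<phi> \<circ> \<psi> has_derivative blinfun_apply \<phi>' \<circ> blinfun_apply \<psi>') (at y0)" .
  moreover have "((\<lambda>x. x) has_derivative (\<lambda>x. x)) (at y0)" by (rule has_derivative_ident)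
  then have "(\<phi> \<circ> \<psi> has_derivative (\<lambda>x. x)) (at y0)"
    by (rule has_derivative_transform_within_open[OF _ V y0(2)]) (use hom in \<open>simp add: homeomorphism_def\<close>)
  ultimately have "blinfun_apply \<phi>' \<circ> blinfun_apply \<psi>' = (\<lambda>x. x)"
    by (rule has_derivative_unique)
  then have inj: "inj (blinfun_apply \<psi>')" by (metis inj_on_id2 inj_on_imageI2)
  have lin\<psi>': "linear (blinfun_apply \<psi>')" by (simp add: blinfun.bounded_linear_right bounded_linear.linear)
  interpret \<psi>': linear "blinfun_apply \<psi>'" by fact
  define K where "K = {y. P y = 0}"
  have K: "subspace K" unfolding K_def by (simp add: subspace_def P.add P.scaleR P.zero)
  have "P (blinfun_apply \<psi>' \<sigma>) = 0" if \<sigma>: "\<sigma> \<in> S" for \<sigma>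
  proof (rule tangent_of_zero_set_in_kernel[OF L fin lin zero[OF x]])
    define \<gamma> where "\<gamma> t = \<psi> (y0 + t *\<^sub>R \<sigma>)" for t :: real
    show "\<gamma> 0 = x" by (simp add: \<gamma>_def y0)
    have "((\<lambda>t. y0 + t *\<^sub>R \<sigma>) has_derivative (\<lambda>t. t *\<^sub>R \<sigma>)) (at_right 0)"
      by (auto intro!: derivative_eq_intros)
    moreover have "(\<psi> has_derivative blinfun_apply \<psi>') (at (y0 + 0 *\<^sub>R \<sigma>) within (\<lambda>t. y0 + t *\<^sub>R \<sigma>) ` {0<..})"
      using \<psi>' by (simp add: has_derivative_at_withinI)
    ultimately show "(\<gamma> has_vector_derivative blinfun_apply \<psi>' \<sigma>) (at_right 0)"
      unfolding has_vector_derivative_def \<gamma>_def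
      using diff_chain_within by (fastforce simp: o_def blinfun.scaleR_right)
    have "((\<lambda>t. y0 + t *\<^sub>R \<sigma>) \<longlongrightarrow> y0 + 0 *\<^sub>R \<sigma>) (at_right 0)" by (intro tendsto_intros)
    then have "\<forall>\<^sub>F t in at_right 0. y0 + t *\<^sub>R \<sigma> \<in> V"
      using V y0(2) by (intro topological_tendstoD) auto
    then show "\<forall>\<^sub>F t in at_right 0. f (\<gamma> t) = 0"
    proof eventually_elim
      case (elim t)
      then show ?case
        unfolding \<gamma>_def using S(1) y0(1) \<sigma> by (intro zero \<psi>E) (auto intro: subspace_add subspace_scale)
    qed
  qed
  then have sub: "blinfun_apply \<psi>' ` S \<subseteq> K" by (auto simp: K_def)
  have "dim (blinfun_apply \<psi>' ` S) = p"
    using dim_image_eq[OF lin\<psi>' inj_on_subset[OF inj]] S(2) by simp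
  \<comment> \<open>The image of \<open>S\<close> under \<open>\<psi>'\<close> lies in the kernel of
    \<open>P\<close> and has dimension \<open>p\<close>; as the kernel has dimension at most
    \<open>p\<close>, the two coincide.\<close>
  then have KS: "blinfun_apply \<psi>' ` S = K"
    using subspace_dim_equal[OF linear_subspace_image[OF lin\<psi>' S(1)] K sub] dimP by (simp add: K_def)
  obtain \<pi> where \<pi>: "linear \<pi>" "\<And>x. \<pi> x \<in> S" "\<And>x. x \<in> S \<Longrightarrow> \<pi> x = x"
    by (rule orthogonal_projection_exists[OF S(1)]) (rule that)
  interpret \<pi>: linear \<pi> by fact
  have cont\<pi>: "continuous_on A \<pi>" and contP: "continuous_on A P" for A
    using \<pi>(1) P by (simp_all add: linear_continuous_on linear_conv_bounded_linear)
  \<comment> \<open>The images of the two summands of the derivative of \<open>F\<close> are \<open>ker P\<close> and \<open>range P\<close>, which are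
    orthogonal; so the derivative is invertible and \<open>F\<close> is open at \<open>0\<close>.\<close>
  define F where "F u = \<psi> (y0 + \<pi> u) + P (blinfun_apply \<psi>' u)" for u
  define F' where "F' u = blinfun_apply \<psi>' (\<pi> u) + P (blinfun_apply \<psi>' u)" for u
  have linF': "linear F'"
    by (rule linearI) (simp_all add: F'_def \<pi>.add \<pi>.scaleR P.add P.scaleR blinfun.add_right blinfun.scaleR_right scaleR_add_right)
  have "u = 0" if "F' u = 0" for u
  proof -
    define a where "a = blinfun_apply \<psi>' (\<pi> u)"
    have "a \<in> K" using KS \<pi>(2) by (auto simp: a_def)
    then have "a \<bullet> P (blinfun_apply \<psi>' u) = 0" by (simp add: K_def flip: sym)
    moreover have "P (blinfun_apply \<psi>' u) = - a" using that by (simp add: F'_def a_def eq_neg_iff_add_eq_0 add.commute)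
    ultimately have "a = 0" and "P (blinfun_apply \<psi>' u) = 0" by auto
    \<comment> \<open>A vector killed by \<open>P\<close> is tangent, hence \<open>u\<close> lies in
      \<open>S\<close> and \<open>\<pi> u = u\<close>. Then \<open>a\<close> is
      \<open>\<psi>' u\<close> itself, and \<open>a = 0\<close> gives \<open>u = 0\<close>.\<close>
    then have "blinfun_apply \<psi>' u \<in> blinfun_apply \<psi>' ` S" by (simp add: KS) (simp add: K_def)
    then have "u \<in> S" using inj by (auto dest: injD)
    with \<open>a = 0\<close> have "blinfun_apply \<psi>' u = blinfun_apply \<psi>' 0" by (simp add: a_def \<pi>(3))
    then show ?thesis by (rule injD[OF inj])
  qed
  then have "inj F'" using linear_injective_0[OF linF'] by blast
  then obtain G where G: "linear G" "\<And>u. F' (G u) = u"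
    using linear_injective_isomorphism[OF linF'] by metis
  define D where "D = {u. y0 + \<pi> u \<in> V}"
  \<comment> \<open>Restricting the parameter to \<open>T\<close> keeps the foot point
    \<open>\<psi> (y0 + \<pi> u)\<close> in \<open>ball x r\<close>.\<close>
  define T where "T = {u \<in> D. \<psi> (y0 + \<pi> u) \<in> ball x r}"
  have contD: "continuous_on D (\<lambda>u. \<psi> (y0 + \<pi> u))"
    by (intro continuous_on_compose2[OF cont\<psi>] continuous_intros cont\<pi>) (auto simp: D_def)
  have "open D" unfolding D_def
    using open_vimage[OF V, of "\<lambda>u. y0 + \<pi> u"] by (simp add: vimage_def continuous_intros cont\<pi>)
  then have "open T" unfolding T_def
    using continuous_open_preimage[OF contD _ open_ball[of x r]] by (simp add: vimage_def Int_def)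
  moreover have "0 \<in> T" using y0 r by (simp add: T_def D_def \<pi>.zero)
  ultimately have "F 0 \<in> interior (F ` T)"
  proof (intro sussmann_open_mapping[OF \<open>open D\<close>, of F 0 F' G T])
    show "continuous_on D F"
      unfolding F_def by (intro continuous_intros contD continuous_on_compose2[OF contP]) auto
    show "(F has_derivative F') (at 0)"
    proof -
      have "((\<lambda>u. y0 + \<pi> u) has_derivative \<pi>) (at 0)"
        using linear_imp_has_derivative[OF \<pi>(1)] by (auto intro!: derivative_eq_intros)
      moreover have "(\<psi> has_derivative blinfun_apply \<psi>') (at (y0 + \<pi> 0))" using \<psi>' by (simp add: \<pi>.zero)
      ultimately have 1: "((\<lambda>u. \<psi> (y0 + \<pi> u)) has_derivative (\<lambda>u. blinfun_apply \<psi>' (\<pi> u))) (at 0)"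
        using diff_chain_at by (fastforce simp: o_def)
      have "linear (\<lambda>u. P (blinfun_apply \<psi>' u))"
        using linear_compose[OF lin\<psi>' P] by (simp add: o_def)
      then have "((\<lambda>u. P (blinfun_apply \<psi>' u)) has_derivative (\<lambda>u. P (blinfun_apply \<psi>' u))) (at 0)"
        by (rule linear_imp_has_derivative)
      from has_derivative_add[OF 1 this] show ?thesis unfolding F_def F'_def .
    qed
    show "bounded_linear G" using G(1) by (simp add: linear_conv_bounded_linear)
    show "F' \<circ> G = id" using G(2) by (auto simp: fun_eq_iff)
  qed (auto simp: T_def interior_open)
  moreover have "F 0 = x" by (simp add: F_def \<pi>.zero y0 P.zero blinfun.zero_right)
  ultimately obtain \<rho> where \<rho>: "0 < \<rho>" "ball x \<rho> \<subseteq> F ` T"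
    by (auto simp: mem_interior)
  show thesis
  proof
    show "0 < \<rho>" by fact
    fix y assume "y \<in> ball x \<rho>"
    then obtain u where u: "u \<in> T" "y = F u" using \<rho>(2) by blast
    then have "\<psi> (y0 + \<pi> u) \<in> E \<inter> ball x r"
      using \<psi>E[of "y0 + \<pi> u"] S(1) y0(1) \<pi>(2)[of u] by (auto simp: T_def D_def subspace_add)
    with u(2) show "\<exists>z\<in>E \<inter> ball x r. \<exists>w. y = z + P w" by (auto simp: F_def)
  qed
qed

subsection \<open>Existence and continuation of solutions\<close>

text \<open>Needed to contradict maximality at a finite end time. The solution is the fixed point of
  the integral operator on bounded continuous functions.\<close>

lemma Picard_local_existence:
  fixes f :: "'a::euclidean_space \<Rightarrow> 'a"
  assumes lip: "L-lipschitz_on (cball z \<rho>) f" and \<rho>: "0 < \<rho>"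
  obtains h y where "0 < h" "y 0 = z" "\<And>t. 0 \<le> t \<Longrightarrow> t \<le> h \<Longrightarrow> (y has_vector_derivative f (y t)) (at t within {0..h})"
proof -
  \<comment> \<open>Composing with the nearest-point map makes the field globally Lipschitz and bounded.\<close>
  define F where "F = f \<circ> closest_point (cball z \<rho>)"
  define B where "B = norm (f z) + L * \<rho>"
  have L: "0 \<le> L" using lip by (rule lipschitz_on_nonneg)
  have ne: "cball z \<rho> \<noteq> {}" using \<rho> by simp
  have cp: "closest_point (cball z \<rho>) v \<in> cball z \<rho>" for v
    using closest_point_in_set[OF closed_cball ne] .
  have F_lip: "norm (F u - F v) \<le> L * norm (u - v)" for u v
  proof -
    have "norm (F u - F v) \<le> L * dist (closest_point (cball z \<rho>) u) (closest_point (cball z \<rho>) v)"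
      using lipschitz_onD[OF lip cp cp] by (simp add: F_def dist_norm)
    also have "\<dots> \<le> L * dist u v"
      using closest_point_lipschitz[OF convex_cball closed_cball ne] L by (intro mult_left_mono) auto
    finally show ?thesis by (simp add: dist_norm)
  qed
  have F_bd: "norm (F v) \<le> B" for v
  proof -
    have "norm (f (closest_point (cball z \<rho>) v) - f z) \<le> L * dist (closest_point (cball z \<rho>) v) z"
      using lipschitz_onD[OF lip cp, of z] \<rho> by (simp add: dist_norm)
    also have "\<dots> \<le> L * \<rho>" using cp[of v] L by (intro mult_left_mono) (auto simp: dist_commute)
    finally show ?thesis
      using norm_triangle_ineq2[of "F v" "f z"] by (simp add: F_def B_def)
  qed
  have B: "0 \<le> B" using F_bd[of z] norm_ge_zero order_trans by blast
  have F_cont: "continuous_on A F" for A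
    using F_lip L by (intro lipschitz_on_continuous_on[of L] lipschitz_onI) (auto simp: dist_norm)
  \<comment> \<open>The first bound makes the integral operator a contraction with factor 1/2; the
    second keeps its values in \<open>cball z \<rho>\<close>, where \<open>F\<close> and
    \<open>f\<close> agree.\<close>
  define h where "h = min (1 / (2 * (L + 1))) (\<rho> / (B + 1))"
  have h: "0 < h" "L * h \<le> 1 / 2" "B * h \<le> \<rho>"
  proof -
    show "0 < h" using L B \<rho> by (simp add: h_def)
    have "L * h \<le> L * (1 / (2 * (L + 1)))" using L by (intro mult_left_mono) (auto simp: h_def)
    also have "\<dots> \<le> 1 / 2" using L by (simp add: field_simps)
    finally show "L * h \<le> 1 / 2" .
    have "B * h \<le> B * (\<rho> / (B + 1))" using B by (intro mult_left_mono) (auto simp: h_def)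
    also have "\<dots> \<le> \<rho>" using B \<rho> by (simp add: field_simps)
    finally show "B * h \<le> \<rho>" .
  qed
  \<comment> \<open>Clamping time to \<open>[0, h]\<close> lets the fixed point live in the complete
    space of bounded continuous functions on the whole line.\<close>
  define cl where "cl t = max 0 (min h t)" for t :: real
  have cl: "0 \<le> cl t" "cl t \<le> h" for t using h(1) by (auto simp: cl_def)
  define \<Phi> where "\<Phi> v t = z + integral {0..cl t} (\<lambda>s. F (apply_bcontfun v s))" for v :: "real \<Rightarrow>\<^sub>C 'a" and t
  have F_comp: "continuous_on A (\<lambda>s. F (apply_bcontfun v s))" for v :: "real \<Rightarrow>\<^sub>C 'a" and A
    by (rule continuous_on_compose2[OF F_cont[of UNIV]]) auto
  have intg: "(\<lambda>s. F (apply_bcontfun v s)) integrable_on {a..b}" for v :: "real \<Rightarrow>\<^sub>C 'a" and a b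
    by (intro integrable_continuous_real F_comp)
  have \<Phi>_bd: "norm (integral {0..cl t} (\<lambda>s. F (apply_bcontfun v s))) \<le> B * h" for v t
  proof -
    have "norm (integral {0..cl t} (\<lambda>s. F (apply_bcontfun v s))) \<le> B * (cl t - 0)"
      by (rule integral_bound) (use cl F_bd F_comp in auto)
    also have "\<dots> \<le> B * h" using cl B by (intro mult_left_mono) auto
    finally show ?thesis .
  qed
  have "\<Phi> v \<in> bcontfun" for v
  proof (rule bcontfun_normI)
    have "continuous_on {0..h} (\<lambda>t. integral {0..t} (\<lambda>s. F (apply_bcontfun v s)))"
      by (intro indefinite_integral_continuous_1 intg)
    moreover have "continuous_on UNIV cl" unfolding cl_def by (intro continuous_intros)
    ultimately have "continuous_on UNIV (\<lambda>t. integral {0..cl t} (\<lambda>s. F (apply_bcontfun v s)))"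
      by (rule continuous_on_compose2) (use cl in auto)
    then show "continuous_on UNIV (\<Phi> v)"
      unfolding \<Phi>_def by (intro continuous_intros)
    show "norm (\<Phi> v t) \<le> norm z + B * h" for t
      unfolding \<Phi>_def by (intro order_trans[OF norm_triangle_ineq] add_left_mono \<Phi>_bd)
  qed
  then have app: "apply_bcontfun (Bcontfun (\<Phi> v)) = \<Phi> v" for v
    by (rule Bcontfun_inverse)
  have "\<exists>!v. Bcontfun (\<Phi> v) = v"
  proof (rule banach_fix_type[of "1 / 2"])
    show "\<forall>v w. dist (Bcontfun (\<Phi> v)) (Bcontfun (\<Phi> w)) \<le> 1 / 2 * dist v w"
    proof (intro allI dist_bound)
      fix v w :: "real \<Rightarrow>\<^sub>C 'a" and t
      have "dist (\<Phi> v t) (\<Phi> w t) = norm (integral {0..cl t} (\<lambda>s. F (apply_bcontfun v s) - F (apply_bcontfun w s)))"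
        by (simp add: \<Phi>_def dist_norm integral_diff[OF intg intg])
      also have "\<dots> \<le> (L * dist v w) * (cl t - 0)"
      proof (rule integral_bound)
        show "continuous_on {0..cl t} (\<lambda>s. F (apply_bcontfun v s) - F (apply_bcontfun w s))"
          by (intro continuous_intros F_comp)
        fix s
        have "norm (F (apply_bcontfun v s) - F (apply_bcontfun w s)) \<le> L * dist (apply_bcontfun v s) (apply_bcontfun w s)"
          using F_lip by (simp add: dist_norm)
        also have "\<dots> \<le> L * dist v w" using L dist_bounded by (intro mult_left_mono)
        finally show "norm (F (apply_bcontfun v s) - F (apply_bcontfun w s)) \<le> L * dist v w" .
      qed (use cl in auto)
      also have "\<dots> \<le> L * dist v w * h" using cl L by (intro mult_left_mono) auto
      also have "\<dots> = (L * h) * dist v w" by simp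
      also have "\<dots> \<le> 1 / 2 * dist v w" using h(2) by (intro mult_right_mono) auto
      finally show "dist (apply_bcontfun (Bcontfun (\<Phi> v)) t) (apply_bcontfun (Bcontfun (\<Phi> w)) t) \<le> 1 / 2 * dist v w"
        by (simp add: app)
    qed
  qed auto
  then obtain v where v: "Bcontfun (\<Phi> v) = v" by blast
  define y where "y = apply_bcontfun v"
  have y\<Phi>: "y t = z + integral {0..cl t} (\<lambda>s. F (apply_bcontfun v s))" for t
    using fun_cong[OF app[of v, unfolded v], of t] unfolding y_def \<Phi>_def .
  have y: "y t = z + integral {0..t} (\<lambda>s. F (y s))" if "0 \<le> t" "t \<le> h" for t
  proof -
    have "cl t = t" using that by (simp add: cl_def)
    then show ?thesis using y\<Phi>[of t] by (simp add: y_def)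
  qed
  have "F (y t) = f (y t)" for t
  proof -
    have "dist z (y t) \<le> \<rho>"
      using \<Phi>_bd[of t v] h(3) unfolding y\<Phi> by (simp add: dist_norm)
    then show ?thesis by (simp add: F_def closest_point_self)
  qed
  moreover have "(y has_vector_derivative F (y t)) (at t within {0..h})" if "0 \<le> t" "t \<le> h" for t
  proof (rule has_vector_derivative_transform)
    have "continuous_on {0..h} (\<lambda>s. F (y s))"
      unfolding y_def by (rule F_comp)
    from integral_has_vector_derivative[OF this, of t]
    show "((\<lambda>u. z + integral {0..u} (\<lambda>s. F (y s))) has_vector_derivative F (y t)) (at t within {0..h})"
      using that by (auto intro!: derivative_eq_intros)
  qed (use that y in auto)
  ultimately show thesis using that[of h y] h(1) y[of 0] by simp
qed

text \<open>A solution with a limit at a finite end time is glued to the local solution started at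
  that limit, so it is not maximal. The glued curve ignores the value \<open>x \<tau>\<close>, which
  is arbitrary.\<close>

lemma solution_extends:
  fixes f :: "'a::euclidean_space \<Rightarrow> 'a"
  assumes sol: "solves_forward f (ereal \<tau>) x" and lim: "(x \<longlongrightarrow> z) (at_left \<tau>)"
    and cont: "continuous_on UNIV f" and lip: "L-lipschitz_on (cball z \<rho>) f" and \<rho>: "0 < \<rho>"
  shows "\<not> trajectory f (ereal \<tau>) x"
proof -
  have \<tau>: "0 < \<tau>" using sol by (simp add: solves_forward_def)
  have "{s. 0 \<le> s \<and> ereal s < ereal \<tau>} = {0..<\<tau>}" by auto
  then have x': "(x has_vector_derivative f (x t)) (at t within {0..<\<tau>})" if "0 \<le> t" "t < \<tau>" for t
    using sol that by (simp add: solves_forward_def)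
  obtain h Y where h: "0 < h" and Y0: "Y 0 = z"
    and Y: "\<And>t. 0 \<le> t \<Longrightarrow> t \<le> h \<Longrightarrow> (Y has_vector_derivative f (Y t)) (at t within {0..h})"
    by (rule Picard_local_existence[OF lip \<rho>]) (rule that)
  define y where "y t = (if t < \<tau> then x t else Y (t - \<tau>))" for t
  have "continuous (at t within {0..\<tau>}) y" if "0 \<le> t" "t \<le> \<tau>" for t
  proof (cases "t = \<tau>")
    case True
    have "\<forall>\<^sub>F t in at_left \<tau>. x t = y t"
      by (auto simp: y_def eventually_at_filter)
    then have "(y \<longlongrightarrow> z) (at_left \<tau>)" by (rule Lim_transform_eventually[OF lim])
    moreover have "y \<tau> = z" using Y0 by (simp add: y_def)
    ultimately show ?thesis using \<tau> by (simp add: True continuous_within at_within_Icc_at_left)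
  next
    case False
    then have "t < \<tau>" using that by simp
    moreover have "at t within {0..<\<tau>} = at t within {0..\<tau>}"
      using \<open>t < \<tau>\<close> by (intro at_within_nhd[of _ "{..<\<tau>}"]) auto
    ultimately have "continuous (at t within {0..\<tau>}) x"
      using has_vector_derivative_continuous[OF x'[of t]] that by simp
    then show ?thesis
    proof (rule continuous_transform_within)
      show "0 < \<tau> - t" using \<open>t < \<tau>\<close> by simp
    qed (use that in \<open>auto simp: y_def dist_real_def\<close>)
  qed
  then have "continuous_on {0..\<tau>} y" by (auto simp: continuous_on_eq_continuous_within)
  moreover have "continuous_on {\<tau>..\<tau> + h} y"
  proof (rule continuous_on_eq)
    have "continuous_on {0..h} Y"
      using has_vector_derivative_continuous[OF Y] by (auto simp: continuous_on_eq_continuous_within)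
    then show "continuous_on {\<tau>..\<tau> + h} (\<lambda>t. Y (t - \<tau>))"
      by (rule continuous_on_compose2) (auto intro!: continuous_intros)
  qed (auto simp: y_def)
  ultimately have "continuous_on ({0..\<tau>} \<union> {\<tau>..\<tau> + h}) y"
    by (intro continuous_on_closed_Un) auto
  moreover have "{0..\<tau>} \<union> {\<tau>..\<tau> + h} = {0..\<tau> + h}" using \<tau> h by auto
  ultimately have conty: "continuous_on {0..\<tau> + h} y" by simp
  have y': "(y has_vector_derivative f (y t)) (at t)" if "0 < t" "t < \<tau> + h" "t \<noteq> \<tau>" for t
  proof (cases "t < \<tau>")
    case True
    have "at t within {0..<\<tau>} = at t"
      using True that by (intro at_within_interior) auto
    then have "(x has_vector_derivative f (y t)) (at t)"
      using x'[of t] True that by (simp add: y_def)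
    then show ?thesis
      by (rule has_vector_derivative_transform_within_open[where S = "{0<..<\<tau>}"])
        (use True that in \<open>auto simp: y_def\<close>)
  next
    case False
    then have t: "\<tau> < t" using that by simp
    have "at (t - \<tau>) within {0..h} = at (t - \<tau>)"
      using t that by (intro at_within_interior) auto
    then have "(Y has_vector_derivative f (y t)) (at (t - \<tau>))"
      using Y[of "t - \<tau>"] t that by (simp add: y_def)
    moreover have "((\<lambda>t. t - \<tau>) has_vector_derivative 1) (at t)"
      by (auto intro!: derivative_eq_intros)
    ultimately have "((\<lambda>t. Y (t - \<tau>)) has_vector_derivative f (y t)) (at t)"
      using vector_diff_chain_at[of "\<lambda>t. t - \<tau>" 1 t Y] by (simp add: o_def)
    then show ?thesis
      by (rule has_vector_derivative_transform_within_open[where S = "{\<tau><..}"])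
        (use t in \<open>auto simp: y_def\<close>)
  qed
  \<comment> \<open>Passing through the integral equation gives differentiability at the gluing time \<open>\<tau>\<close> as well.\<close>
  have y_int: "y t = y 0 + integral {0..t} (\<lambda>s. f (y s))" if "t \<in> {0..\<tau> + h}" for t
  proof -
    have "((\<lambda>s. f (y s)) has_integral (y t - y 0)) {0..t}"
      by (rule fundamental_theorem_of_calculus_interior_strong[of "{\<tau>}"])
        (use that y' continuous_on_subset[OF conty] in auto)
    then show ?thesis by (simp add: integral_unique)
  qed
  have y'': "(y has_vector_derivative f (y t)) (at t within {0..\<tau> + h})" if "t \<in> {0..\<tau> + h}" for t
  proof (rule has_vector_derivative_transform[OF that y_int])
    have "continuous_on {0..\<tau> + h} (\<lambda>s. f (y s))"
      by (rule continuous_on_compose2[OF cont conty]) auto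
    from integral_has_vector_derivative[OF this that]
    show "((\<lambda>u. y 0 + integral {0..u} (\<lambda>s. f (y s))) has_vector_derivative f (y t)) (at t within {0..\<tau> + h})"
      by (auto intro!: derivative_eq_intros)
  qed
  have eq: "{s. 0 \<le> s \<and> ereal s < ereal (\<tau> + h)} = {0..<\<tau> + h}" by auto
  have "solves_forward f (ereal (\<tau> + h)) y"
    unfolding solves_forward_def eq using \<tau> h
    by (auto intro!: has_vector_derivative_within_subset[OF y''])
  then show ?thesis
    unfolding trajectory_def using h by (auto simp: y_def intro!: exI[of _ "ereal (\<tau> + h)"] exI[of _ y])
qed

text \<open>A Cauchy argument, phrased for filters so that it serves both a finite end time
  (\<open>at_left \<tau>\<close>) and infinity (\<open>at_top\<close>).\<close>

lemma converges_if_dominated: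
  fixes x :: "'b \<Rightarrow> 'a::complete_space" and \<phi> :: "'b \<Rightarrow> real"
  assumes \<phi>: "(\<phi> \<longlongrightarrow> l) F" and Q: "eventually Q F"
    and dom: "\<And>a b. Q a \<Longrightarrow> Q b \<Longrightarrow> dist (x a) (x b) \<le> \<bar>\<phi> a - \<phi> b\<bar>" and F: "F \<noteq> bot"
  shows "\<exists>z. (x \<longlongrightarrow> z) F"
proof -
  have "cauchy_filter (filtermap x F)"
    unfolding cauchy_filter_metric_filtermap
  proof (intro allI impI)
    fix e :: real assume "0 < e"
    then have "\<forall>\<^sub>F t in F. dist (\<phi> t) l < e / 2" using \<phi> by (intro tendstoD) auto
    with Q have "\<forall>\<^sub>F t in F. Q t \<and> dist (\<phi> t) l < e / 2" by (rule eventually_conj)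
    moreover have "dist (x a) (x b) < e" if "Q a \<and> dist (\<phi> a) l < e / 2" "Q b \<and> dist (\<phi> b) l < e / 2" for a b
    proof -
      have "\<bar>\<phi> a - \<phi> b\<bar> < e" using that by (simp add: dist_real_def) argo
      then show ?thesis using dom[of a b] that by linarith
    qed
    ultimately show "\<exists>P. eventually P F \<and> (\<forall>a b. P a \<and> P b \<longrightarrow> dist (x a) (x b) < e)" by blast
  qed
  then obtain z where "filtermap x F \<le> nhds z"
    using cauchy_filter_complete_converges[of "filtermap x F" UNIV] F by (auto simp: complete_UNIV filtermap_bot_iff)
  then show ?thesis by (auto simp: filterlim_def)
qed

subsection \<open>Decay of the velocity\<close>

text \<open>With \<open>z\<close> in \<open>E\<close> the foot point of \<open>y\<close>, the
  Lipschitz condition gives \<open>norm (f y) \<le> \<Lambda> * norm (y - z)\<close>, and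
  \<open>norm (y - z)\<close> is bounded by \<open>P (f y)\<close>. The same estimate shows that a
  zero \<open>y\<close> coincides with \<open>z\<close>, so near \<open>x\<close> there are no
  equilibria outside \<open>E\<close>; this later places the limits of trajectories in
  \<open>E\<close>.\<close>

lemma field_bound_near_zero_set:
  fixes f :: "'a::euclidean_space \<Rightarrow> 'a"
  assumes mfd: "submanifold p E" and x: "x \<in> E" and zero: "\<And>y. y \<in> E \<Longrightarrow> f y = 0"
    and L: "lyapunov_for P J" and fin: "finite J" and lin: "linearized_by f x J"
    and dimP: "dim {y. P y = 0} \<le> p" and cont: "continuous_on UNIV f"
    and lip: "\<Lambda>-lipschitz_on (cball x \<rho>) f" and \<rho>: "0 < \<rho>"
  obtains r C where "0 < r" "0 < C" "\<And>y. y \<in> ball x r \<Longrightarrow> norm (f y) \<le> C * norm (P (f y))"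
    "\<And>y. y \<in> ball x r \<Longrightarrow> f y = 0 \<Longrightarrow> y \<in> E"
proof -
  have P0: "P 0 = 0" using L linear_0 by (auto simp: lyapunov_for_def)
  have \<Lambda>: "0 \<le> \<Lambda>" using lip by (rule lipschitz_on_nonneg)
  obtain r1 C where r1: "0 < r1" and C: "0 < C"
    "\<And>y z w. y \<in> ball x r1 \<Longrightarrow> z \<in> ball x r1 \<Longrightarrow> f z = 0 \<Longrightarrow> y = z + P w \<Longrightarrow> norm (y - z) \<le> C * norm (P (f y))"
    by (rule zero_set_error_bound[OF L fin lin cont]) (rule that)
  define r2 where "r2 = min r1 \<rho>"
  have r2: "0 < r2" using r1 \<rho> by (simp add: r2_def)
  obtain r3 where r3: "0 < r3" "\<And>y. y \<in> ball x r3 \<Longrightarrow> \<exists>z\<in>E \<inter> ball x r2. \<exists>w. y = z + P w"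
    by (rule submanifold_transversal[OF mfd x _ L fin lin dimP r2]) (erule zero, rule that)
  define r where "r = min r2 r3"
  have key: "\<exists>z\<in>E. norm (y - z) \<le> C * norm (P (f y)) \<and> norm (f y) \<le> \<Lambda> * norm (y - z)" if "y \<in> ball x r" for y
  proof -
    obtain z w where z: "z \<in> E" "z \<in> ball x r2" "y = z + P w" using r3(2)[of y] \<open>y \<in> ball x r\<close> by (auto simp: r_def)
    have "norm (y - z) \<le> C * norm (P (f y))"
      using that z zero[OF z(1)] by (intro C(2)[of y z w]) (auto simp: r_def r2_def)
    moreover have "norm (f y) \<le> \<Lambda> * norm (y - z)"
      using lipschitz_onD[OF lip, of y z] that z zero[OF z(1)] by (auto simp: r_def r2_def dist_norm)
    ultimately show ?thesis using z(1) by blast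
  qed
  show thesis
  proof
    show "0 < r" using r2 r3 by (simp add: r_def)
    \<comment> \<open>The summand 1 keeps the constant positive when \<open>\<Lambda>\<close> is
      0.\<close>
    show "0 < (\<Lambda> + 1) * C" using \<Lambda> C(1) by simp
    show "norm (f y) \<le> (\<Lambda> + 1) * C * norm (P (f y))" if y: "y \<in> ball x r" for y
    proof -
      obtain z where "norm (y - z) \<le> C * norm (P (f y))" "norm (f y) \<le> \<Lambda> * norm (y - z)"
        using key[OF y] by blast
      then have "norm (f y) \<le> \<Lambda> * (C * norm (P (f y)))" using \<Lambda> by (meson mult_left_mono order_trans)
      also have "\<dots> \<le> (\<Lambda> + 1) * (C * norm (P (f y)))" using C(1) by (intro mult_right_mono) auto
      finally show ?thesis by (simp add: mult.assoc)
    qed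
    show "y \<in> E" if "y \<in> ball x r" "f y = 0" for y
      using key[OF that(1)] that(2) by (auto simp: P0)
  qed
qed

text \<open>At the end time only continuity is asked for, not membership in \<open>S\<close>. The
  notion therefore still applies at the first exit time from a ball.\<close>

definition solution_in :: "('a::real_normed_vector \<Rightarrow> 'a) \<Rightarrow> 'a set \<Rightarrow> real \<Rightarrow> (real \<Rightarrow> 'a) \<Rightarrow> bool" where
  "solution_in f S b x \<longleftrightarrow> 0 \<le> b \<and> continuous_on {0..b} x \<and>
     (\<forall>s\<in>{0..<b}. x s \<in> S \<and> (x has_vector_derivative f (x s)) (at s within {0..b}))"

lemma solution_in_restrict:
  assumes "solution_in f S b x" "0 \<le> a" "a \<le> b"
  shows "solution_in f S a x"
proof -
  have "(x has_vector_derivative f (x s)) (at s within {0..a})" if "0 \<le> s" "s < a" for s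
    by (rule has_vector_derivative_within_subset[of _ _ _ "{0..b}"])
      (use assms that in \<open>auto simp: solution_in_def\<close>)
  then show ?thesis
    using assms by (auto simp: solution_in_def intro: continuous_on_subset)
qed

text \<open>Writing \<open>d\<close> for the velocity and \<open>q\<close> for its increment, the
  energy changes by \<open>2 * (P d \<bullet> q) + q \<bullet> P q\<close>. The first term is
  dissipative to first order in time, up to the linearization error; the second is of second
  order.\<close>

lemma field_energy_decay:
  fixes f :: "'a::euclidean_space \<Rightarrow> 'a"
  assumes L: "lyapunov_for P J" and fin: "finite J" and lin: "linearized_by f x0 J"
    and cont: "continuous_on UNIV f"
    and C: "0 < C" and r0: "0 < r0" "\<And>y. y \<in> ball x0 r0 \<Longrightarrow> norm (f y) \<le> C * norm (P (f y))"
  obtains r \<kappa> where "0 < r" "r \<le> r0" "0 < \<kappa>"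
    "\<And>x b. solution_in f (ball x0 r) b x \<Longrightarrow>
      f (x b) \<bullet> P (f (x b)) \<le> f (x 0) \<bullet> P (f (x 0)) * exp (- \<kappa> * b)"
proof -
  have P: "linear P" and sym: "\<And>x y. P x \<bullet> y = x \<bullet> P y"
    using L unfolding lyapunov_for_def by blast+
  interpret P: linear P by fact
  obtain c where c: "0 < c" "\<And>M x. M \<in> J \<Longrightarrow> P x \<bullet> blinfun_apply M x \<le> - c * (norm (P x))\<^sup>2"
    by (rule lyapunov_for_bounds[OF L fin]) (rule that)
  obtain Bp where Bp: "0 < Bp" "\<And>x. norm (P x) \<le> Bp * norm x" using linear_bounded_pos[OF P] by blast
  \<comment> \<open>Since \<open>norm d \<le> C * norm (P d)\<close>, the error is at most
    \<open>c / 2 * (norm (P d))\<^sup>2\<close>, half of the dissipation.\<close>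
  define \<epsilon> where "\<epsilon> = c / (2 * C)"
  have \<epsilon>: "0 < \<epsilon>" using c(1) C by (simp add: \<epsilon>_def)
  obtain r1 where r1: "0 < r1" "\<And>\<gamma> d s \<delta>. \<gamma> s \<in> ball x0 r1 \<Longrightarrow> (\<gamma> has_vector_derivative d) (at_right s) \<Longrightarrow> 0 < \<delta> \<Longrightarrow>
     (\<forall>\<^sub>F t in at_right s. \<exists>M\<in>J.
        norm (f (\<gamma> t) - f (\<gamma> s) - (t - s) *\<^sub>R blinfun_apply M d) \<le> (\<delta> + \<epsilon> * norm d) * (t - s))"
    using lin \<epsilon> unfolding linearized_by_def by blast
  define W where "W y = f y \<bullet> P (f y)" for y
  \<comment> \<open>\<open>W y\<close> is at most \<open>C\<close> times the squared norm of
    \<open>P (f y)\<close>, so dissipation with constant \<open>c\<close> is decay at rate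
    \<open>c / C\<close>.\<close>
  define \<kappa> where "\<kappa> = c / C"
  have contP: "continuous_on A P" for A
    using P by (simp add: linear_continuous_on linear_conv_bounded_linear)
  have contW: "continuous_on UNIV W"
    unfolding W_def by (intro continuous_intros cont continuous_on_compose2[OF contP cont]) auto
  show thesis
  proof
    show "0 < min r0 r1" "min r0 r1 \<le> r0" using r0 r1 by auto
    show "0 < \<kappa>" using c(1) C by (simp add: \<kappa>_def)
    fix x b assume sol: "solution_in f (ball x0 (min r0 r1)) b x"
    then have b: "0 \<le> b" and contx: "continuous_on {0..b} x"
      and ball: "\<And>s. 0 \<le> s \<Longrightarrow> s < b \<Longrightarrow> x s \<in> ball x0 (min r0 r1)"
      by (auto simp: solution_in_def)
    have x': "(x has_vector_derivative f (x s)) (at_right s)" if "0 \<le> s" "s < b" for s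
    proof -
      have "(x has_vector_derivative f (x s)) (at s within {0..b})"
        using sol that by (auto simp: solution_in_def)
      then have "(x has_vector_derivative f (x s)) (at s within {s..b})"
        by (rule has_vector_derivative_within_subset) (use that in auto)
      moreover have "at s within {s..b} = at_right s" using that by (intro at_within_Icc_at_right) simp
      ultimately show ?thesis by simp
    qed
    have "W (x b) \<le> W (x 0) * exp (- \<kappa> * (b - 0))"
    proof (rule Dini_exponential_decay[OF b])
      show "continuous_on {0..b} (\<lambda>t. W (x t))"
        by (rule continuous_on_compose2[OF contW contx]) auto
      fix s \<delta> :: real assume s: "0 \<le> s" "s < b" and \<delta>: "0 < \<delta>"
      define d where "d = f (x s)"
      define n where "n = norm (P d)"
      define \<eta> where "\<eta> = \<delta> / (4 * (n + 1))"
      have n: "0 \<le> n" by (simp add: n_def)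
      have \<eta>: "0 < \<eta>" using \<delta> n by (simp add: \<eta>_def)
      have \<eta>n: "n * \<eta> \<le> \<delta> / 4" using \<delta> n by (simp add: \<eta>_def field_simps)
      have d: "norm d \<le> C * n" using r0(2)[of "x s"] ball[OF s] by (simp add: d_def n_def)
      \<comment> \<open>\<open>Z\<close> bounds \<open>norm q / (t - s)\<close>; summing over
        \<open>J\<close> removes the dependence on the \<open>M\<close> chosen for \<open>t\<close>.
        For \<open>t - s\<close> below \<open>\<mu>\<close> the quadratic term is then at most
        \<open>\<delta> / 2 * (t - s)\<close>.\<close>
      define Z where "Z = (\<Sum>M\<in>J. norm (blinfun_apply M d)) + \<eta> + \<epsilon> * norm d"
      have Z: "0 \<le> Z" unfolding Z_def using \<eta> \<epsilon> by (intro add_nonneg_nonneg sum_nonneg) auto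
      define \<mu> where "\<mu> = \<delta> / (2 * (Bp * Z\<^sup>2 + 1))"
      have BZ: "0 \<le> Bp * Z\<^sup>2" using Bp(1) by simp
      have \<mu>: "0 < \<mu>" unfolding \<mu>_def using \<delta> BZ by (intro divide_pos_pos) auto
      have \<mu>B: "Bp * Z\<^sup>2 * \<mu> \<le> \<delta> / 2" using \<delta> BZ by (simp add: \<mu>_def field_simps)
      have "x s \<in> ball x0 r1" using ball[OF s] by simp
      have "\<forall>\<^sub>F t in at_right s. t < s + \<mu>"
        using \<mu> by (auto simp: eventually_at_right[of s "s + 1"] intro!: exI[of _ "s + \<mu>"])
      with r1(2)[of x, OF \<open>x s \<in> ball x0 r1\<close> x'[OF s] \<eta>]
      show "\<forall>\<^sub>F t in at_right s. W (x t) \<le> W (x s) + (\<delta> - \<kappa> * W (x s)) * (t - s)"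
        using eventually_at_right_less[of s]
      proof eventually_elim
        case (elim t)
        then obtain M where M: "M \<in> J"
          "norm (f (x t) - d - (t - s) *\<^sub>R blinfun_apply M d) \<le> (\<eta> + \<epsilon> * norm d) * (t - s)"
          by (auto simp: d_def)
        define q where "q = f (x t) - d"
        define e where "e = q - (t - s) *\<^sub>R blinfun_apply M d"
        have e: "norm e \<le> (\<eta> + \<epsilon> * norm d) * (t - s)" using M(2) by (simp add: e_def q_def)
        have "W (x t) - W (x s) = 2 * (P d \<bullet> q) + q \<bullet> P q"
        proof -
          have "f (x t) = d + q" "f (x s) = d" by (simp_all add: q_def d_def)
          then show ?thesis
            by (simp add: W_def P.add inner_add_left inner_add_right inner_commute[of q "P d"] sym[of d q])
        qed
        moreover have "P d \<bullet> q \<le> (t - s) * (- (c / 2) * n\<^sup>2 + \<delta> / 4)"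
        proof -
          have "P d \<bullet> q = (t - s) * (P d \<bullet> blinfun_apply M d) + P d \<bullet> e"
            by (simp add: e_def inner_diff_right)
          also have "\<dots> \<le> (t - s) * (- c * n\<^sup>2) + n * ((\<eta> + \<epsilon> * norm d) * (t - s))"
            unfolding n_def using elim(2,3)
            by (intro add_mono mult_left_mono c(2)[OF M(1)] order_trans[OF norm_cauchy_schwarz] e) auto
          also have "\<dots> = (t - s) * (- c * n\<^sup>2 + n * \<eta> + \<epsilon> * (n * norm d))" by (simp add: algebra_simps)
          also have "\<dots> \<le> (t - s) * (- c * n\<^sup>2 + \<delta> / 4 + \<epsilon> * (n * (C * n)))"
          proof (rule mult_left_mono)
            have "\<epsilon> * (n * norm d) \<le> \<epsilon> * (n * (C * n))" using \<epsilon> n d by (intro mult_left_mono) auto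
            then show "- c * n\<^sup>2 + n * \<eta> + \<epsilon> * (n * norm d) \<le> - c * n\<^sup>2 + \<delta> / 4 + \<epsilon> * (n * (C * n))"
              using \<eta>n by linarith
          qed (use elim(3) in simp)
          also have "\<dots> = (t - s) * (- (c / 2) * n\<^sup>2 + \<delta> / 4)"
            using C by (simp add: \<epsilon>_def power2_eq_square algebra_simps)
          finally show ?thesis .
        qed
        moreover have "q \<bullet> P q \<le> (t - s) * (\<delta> / 2)"
        proof -
          have "norm (blinfun_apply M d) \<le> (\<Sum>M\<in>J. norm (blinfun_apply M d))"
            by (rule member_le_sum[OF M(1)]) (use fin in auto)
          then have "(t - s) * norm (blinfun_apply M d) \<le> (t - s) * (\<Sum>M\<in>J. norm (blinfun_apply M d))"
            using elim(3) by (intro mult_left_mono) auto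
          moreover have "norm q \<le> (t - s) * norm (blinfun_apply M d) + norm e"
            using norm_triangle_ineq[of "(t - s) *\<^sub>R blinfun_apply M d" e] elim(3) by (simp add: e_def)
          ultimately have q: "norm q \<le> (t - s) * Z" using e by (simp add: Z_def algebra_simps)
          have "q \<bullet> P q \<le> norm q * (Bp * norm q)"
            by (intro order_trans[OF norm_cauchy_schwarz] mult_left_mono Bp) auto
          also have "\<dots> = Bp * (norm q)\<^sup>2" by (simp add: power2_eq_square)
          also have "\<dots> \<le> Bp * ((t - s) * Z)\<^sup>2" using Bp(1) q by (intro mult_left_mono power_mono) auto
          also have "\<dots> = (t - s) * (Bp * Z\<^sup>2 * (t - s))" by (simp add: power2_eq_square)
          also have "\<dots> \<le> (t - s) * (Bp * Z\<^sup>2 * \<mu>)"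
            using elim(2,3) BZ by (intro mult_left_mono) auto
          also have "\<dots> \<le> (t - s) * (\<delta> / 2)" using \<mu>B elim(3) by (intro mult_left_mono) auto
          finally show ?thesis .
        qed
        ultimately have "W (x t) - W (x s) \<le> 2 * ((t - s) * (- (c / 2) * n\<^sup>2 + \<delta> / 4)) + (t - s) * (\<delta> / 2)"
          by linarith
        also have "\<dots> = (t - s) * (\<delta> - c * n\<^sup>2)" by (simp add: field_simps)
        also have "\<dots> \<le> (t - s) * (\<delta> - \<kappa> * W (x s))"
        proof -
          have "W (x s) \<le> norm d * n" unfolding W_def n_def d_def by (rule norm_cauchy_schwarz)
          also have "\<dots> \<le> C * n * n" using d n by (intro mult_right_mono) auto
          finally have "\<kappa> * W (x s) \<le> \<kappa> * (C * n * n)"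
            using c(1) C by (intro mult_left_mono) (auto simp: \<kappa>_def)
          also have "\<dots> = c * n\<^sup>2" using C by (simp add: \<kappa>_def power2_eq_square)
          finally show ?thesis using elim(3) by (intro mult_left_mono) auto
        qed
        finally show ?case by (simp add: algebra_simps)
      qed
    qed
    then show "f (x b) \<bullet> P (f (x b)) \<le> f (x 0) \<bullet> P (f (x 0)) * exp (- \<kappa> * b)"
      by (simp add: W_def)
  qed
qed

text \<open>The remaining path length is bounded by a multiple of \<open>sqrt (W (x 0))\<close>,
  which is small near \<open>x0\<close>. A trajectory starting there cannot leave the ball in which
  the decay estimate holds, and this closes the circular dependence between decay and
  confinement.\<close>

lemma local_stability:
  fixes f :: "'a::euclidean_space \<Rightarrow> 'a"
  assumes mfd: "submanifold p E" and x0: "x0 \<in> E" and zero: "\<And>y. y \<in> E \<Longrightarrow> f y = 0"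
    and L: "lyapunov_for P J" and fin: "finite J" and lin: "linearized_by f x0 J"
    and dimP: "dim {y. P y = 0} \<le> p" and cont: "continuous_on UNIV f"
    and lip: "\<Lambda>-lipschitz_on (cball x0 \<rho>) f" and \<rho>: "0 < \<rho>" and \<epsilon>: "0 < \<epsilon>"
  shows "\<exists>\<delta>>0. \<forall>T x. trajectory f T x \<and> x 0 \<in> ball x0 \<delta> \<longrightarrow>
    T = \<infinity> \<and> (\<forall>t\<ge>0. dist (x t) x0 < \<epsilon>) \<and> (\<exists>z\<in>E. (x \<longlongrightarrow> z) at_top)"
proof -
  have P: "linear P" using L unfolding lyapunov_for_def by blast
  interpret P: linear P by fact
  obtain c where c: "0 < c" "\<And>x. c * (norm (P x))\<^sup>2 \<le> x \<bullet> P x"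
    by (rule lyapunov_for_bounds[OF L fin]) (rule that)
  obtain r0 C where r0: "0 < r0" and C: "0 < C" "\<And>y. y \<in> ball x0 r0 \<Longrightarrow> norm (f y) \<le> C * norm (P (f y))"
    and inE: "\<And>y. y \<in> ball x0 r0 \<Longrightarrow> f y = 0 \<Longrightarrow> y \<in> E"
    by (rule field_bound_near_zero_set[OF mfd x0 _ L fin lin dimP cont lip \<rho>]) (erule zero, rule that)
  define W where "W y = f y \<bullet> P (f y)" for y
  obtain r \<kappa> where r: "0 < r" "r \<le> r0" and \<kappa>: "0 < \<kappa>"
    and "\<And>x b. solution_in f (ball x0 r) b x \<Longrightarrow>
      f (x b) \<bullet> P (f (x b)) \<le> f (x 0) \<bullet> P (f (x 0)) * exp (- \<kappa> * b)"
    by (rule field_energy_decay[OF L fin lin cont C(1) r0 C(2)]) (assumption, rule that)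
  note decay = this(4)[folded W_def]
  have contP: "continuous_on A P" for A
    using P by (simp add: linear_continuous_on linear_conv_bounded_linear)
  have contW: "continuous_on UNIV W"
    unfolding W_def by (intro continuous_intros cont continuous_on_compose2[OF contP cont]) auto
  \<comment> \<open>From \<open>norm (f y) \<le> C * norm (P (f y))\<close> and
    \<open>c * (norm (P (f y)))\<^sup>2 \<le> W y\<close>.\<close>
  define K where "K = C / sqrt c"
  have K: "0 < K" using C(1) c(1) by (simp add: K_def)
  have fW: "norm (f y) \<le> K * sqrt (W y)" if "y \<in> ball x0 r0" for y
  proof -
    have "sqrt c * norm (P (f y)) = sqrt (c * (norm (P (f y)))\<^sup>2)" by (simp add: real_sqrt_mult)
    also have "\<dots> \<le> sqrt (W y)" using c(2)[of "f y"] by (simp add: W_def)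
    finally have "norm (P (f y)) \<le> sqrt (W y) / sqrt c" using c(1) by (simp add: field_simps)
    then have "C * norm (P (f y)) \<le> C * (sqrt (W y) / sqrt c)" using C(1) by (intro mult_left_mono) auto
    then show ?thesis using C(2)[OF that] by (simp add: K_def)
  qed
  define A where "A y = K * sqrt (W y)" for y
  \<comment> \<open>An antiderivative of the speed bound
    \<open>A y * exp (- \<kappa> / 2 * t)\<close>; the rate is halved because the speed is compared
    with the square root of \<open>W\<close>. It increases to 0, so the total length is at most
    \<open>2 * A y / \<kappa>\<close>.\<close>
  define \<phi> where "\<phi> y t = - (2 * A y / \<kappa>) * exp (- \<kappa> / 2 * t)" for y and t :: real
  define sol where "sol x b \<longleftrightarrow> solution_in f (ball x0 r) b x" for x b
  have speed: "norm (f (x s)) \<le> A (x 0) * exp (- \<kappa> / 2 * s)" if "sol x b" "0 \<le> s" "s < b" for x b s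
  proof -
    have "sol x s" using that by (auto simp: sol_def intro: solution_in_restrict)
    then have "W (x s) \<le> W (x 0) * exp (- \<kappa> * s)" unfolding sol_def by (rule decay)
    then have "sqrt (W (x s)) \<le> sqrt (W (x 0) * exp (- \<kappa> * s))" by (rule real_sqrt_le_mono)
    also have "exp (- \<kappa> * s) = (exp (- \<kappa> / 2 * s))\<^sup>2" by (simp flip: exp_double)
    also have "sqrt (W (x 0) * (exp (- \<kappa> / 2 * s))\<^sup>2) = sqrt (W (x 0)) * exp (- \<kappa> / 2 * s)"
      by (simp add: real_sqrt_mult)
    finally have "K * sqrt (W (x s)) \<le> K * (sqrt (W (x 0)) * exp (- \<kappa> / 2 * s))"
      using K by (intro mult_left_mono) auto
    moreover have "x s \<in> ball x0 r0" using that r(2) by (force simp: sol_def solution_in_def)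
    ultimately show ?thesis using fW[of "x s"] by (simp add: A_def mult.assoc)
  qed
  have travel: "norm (x b - x a) \<le> \<phi> (x 0) b - \<phi> (x 0) a" if "sol x b" "0 \<le> a" "a \<le> b" for x a b
  proof (cases "a = b")
    case False
    then have "a < b" using that by simp
    then show ?thesis
    proof (rule differentiable_bound_general)
      show "continuous_on {a..b} x" using that by (auto simp: sol_def solution_in_def intro: continuous_on_subset)
      show "continuous_on {a..b} (\<phi> (x 0))" unfolding \<phi>_def by (intro continuous_intros)
      fix s assume s: "a < s" "s < b"
      have "at s within {0..b} = at s" using s that(2) by (intro at_within_interior) auto
      moreover have "(x has_vector_derivative f (x s)) (at s within {0..b})"
        using s that by (auto simp: sol_def solution_in_def)
      ultimately show "(x has_vector_derivative f (x s)) (at s)" by simp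
      show "(\<phi> (x 0) has_vector_derivative A (x 0) * exp (- \<kappa> / 2 * s)) (at s)"
        unfolding \<phi>_def using \<kappa>
        by (auto intro!: derivative_eq_intros simp flip: has_real_derivative_iff_has_vector_derivative)
      show "norm (f (x s)) \<le> A (x 0) * exp (- \<kappa> / 2 * s)" using speed[OF that(1), of s] s that(2) by simp
    qed
  qed simp
  \<comment> \<open>Half of \<open>r\<close> keeps even limit points inside the open ball; half of
    \<open>\<rho>\<close> leaves a Lipschitz ball around a limit point for continuation.\<close>
  define e where "e = min \<epsilon> (min (r / 2) (\<rho> / 2))"
  have e: "0 < e" "e \<le> \<epsilon>" "e \<le> r / 2" "e \<le> \<rho> / 2" using \<epsilon> r(1) \<rho> by (auto simp: e_def)
  have "continuous (at x0) (\<lambda>y. 2 * A y / \<kappa>)"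
    unfolding A_def using contW \<kappa> by (intro continuous_intros) (auto simp: continuous_on_eq_continuous_at)
  moreover have "2 * A x0 / \<kappa> = 0" by (simp add: A_def W_def zero[OF x0])
  ultimately obtain \<delta>1 where \<delta>1: "0 < \<delta>1" "\<And>y. dist y x0 < \<delta>1 \<Longrightarrow> dist (2 * A y / \<kappa>) 0 < e / 2"
    using e(1) unfolding continuous_within_eps_delta by (metis UNIV_I half_gt_zero)
  define \<delta> where "\<delta> = min \<delta>1 (e / 2)"
  have "T = \<infinity> \<and> (\<forall>t\<ge>0. dist (x t) x0 < \<epsilon>) \<and> (\<exists>z\<in>E. (x \<longlongrightarrow> z) at_top)"
    if traj: "trajectory f T x" and start: "x 0 \<in> ball x0 \<delta>" for T x
  proof -
    have T: "0 < T" and x': "\<And>t. 0 \<le> t \<Longrightarrow> ereal t < T \<Longrightarrow>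
       (x has_vector_derivative f (x t)) (at t within {s. 0 \<le> s \<and> ereal s < T})"
      using traj by (auto simp: trajectory_def solves_forward_def)
    have x'b: "(x has_vector_derivative f (x s)) (at s within {0..b})" if "0 \<le> s" "s \<le> b" "ereal b < T" for s b
    proof -
      have "ereal t < T" if "t \<le> b" for t using \<open>ereal b < T\<close> that by (meson ereal_less_eq(3) order_le_less_trans)
      then show ?thesis using that by (intro has_vector_derivative_within_subset[OF x']) auto
    qed
    have contx: "continuous_on {0..b} x" if "ereal b < T" for b
      using that has_vector_derivative_continuous[OF x'b] by (auto simp: continuous_on_eq_continuous_within)
    have \<phi>0: "\<phi> (x 0) t - \<phi> (x 0) 0 < e / 2" for t
    proof -
      have "0 \<le> W (x 0)" using c(2)[of "f (x 0)"] c(1) unfolding W_def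
        by (meson mult_nonneg_nonneg less_imp_le order_trans zero_le_power2)
      then have A0: "0 \<le> 2 * A (x 0) / \<kappa>" using K \<kappa> by (simp add: A_def)
      then have "0 \<le> 2 * A (x 0) / \<kappa> * exp (- \<kappa> / 2 * t)" by (rule mult_nonneg_nonneg) simp
      then have "\<phi> (x 0) t \<le> 0" by (simp add: \<phi>_def)
      moreover have "dist (2 * A (x 0) / \<kappa>) 0 < e / 2"
        using start by (intro \<delta>1(2)) (simp add: \<delta>_def dist_commute)
      then have "2 * A (x 0) / \<kappa> < e / 2" using A0 by (simp only: dist_real_def diff_zero abs_of_nonneg)
      then have "- \<phi> (x 0) 0 < e / 2" by (simp add: \<phi>_def)
      ultimately show ?thesis by simp
    qed
    have close: "dist (x b) x0 < e" if "sol x b" for b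
    proof -
      have "dist (x b) x0 \<le> norm (x b - x 0) + dist (x 0) x0"
        using dist_triangle[of "x b" x0 "x 0"] by (simp add: dist_norm)
      moreover have "dist (x 0) x0 < e / 2" using start by (simp add: \<delta>_def dist_commute)
      moreover have "norm (x b - x 0) < e / 2"
        using travel[OF that, of 0] \<phi>0[of b] that by (simp add: sol_def solution_in_def)
      ultimately show ?thesis by simp
    qed
    \<comment> \<open>At the first time \<open>\<tau>\<close> with distance at least
      \<open>e\<close>, the curve has been in the ball at all earlier times, so \<open>close\<close>
      applies at \<open>\<tau>\<close> itself and gives distance below \<open>e\<close>.\<close>
    have confined: "dist (x t) x0 < e" if t: "0 \<le> t" "ereal t < T" for t
    proof (rule ccontr)
      assume "\<not> dist (x t) x0 < e"
      define S where "S = {s \<in> {0..t}. e \<le> dist (x s) x0}"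
      have "closed S" unfolding S_def
        using contx[OF t(2)] by (intro continuous_on_closed_Collect_le continuous_intros) auto
      moreover have "bounded S" unfolding S_def by (rule bounded_subset[of "{0..t}"]) auto
      ultimately have "compact S" by (simp add: compact_eq_bounded_closed)
      moreover have "t \<in> S" using t \<open>\<not> dist (x t) x0 < e\<close> by (simp add: S_def)
      ultimately obtain \<tau> where \<tau>: "\<tau> \<in> S" "\<And>s. s \<in> S \<Longrightarrow> \<tau> \<le> s"
        using compact_attains_inf[of S] by auto
      have "0 \<le> \<tau>" "\<tau> \<le> t" "e \<le> dist (x \<tau>) x0" using \<tau>(1) by (auto simp: S_def)
      have "ereal \<tau> < T" using \<open>\<tau> \<le> t\<close> t(2) by (meson ereal_less_eq(3) order_le_less_trans)
      have "x s \<in> ball x0 r" if "0 \<le> s" "s < \<tau>" for s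
        using \<tau>(2)[of s] that \<open>\<tau> \<le> t\<close> e(1,3) by (force simp: S_def dist_commute)
      then have "sol x \<tau>"
        using \<open>0 \<le> \<tau>\<close> contx[OF \<open>ereal \<tau> < T\<close>] x'b[OF _ _ \<open>ereal \<tau> < T\<close>] by (simp add: sol_def solution_in_def)
      from close[OF this] \<open>e \<le> dist (x \<tau>) x0\<close> show False by simp
    qed
    have solx: "sol x b" if "0 \<le> b" "ereal b < T" for b
    proof -
      have "x s \<in> ball x0 r" if "0 \<le> s" "s < b" for s
      proof -
        have "ereal s < T" using that \<open>ereal b < T\<close> by (meson ereal_less(2) less_ereal.simps(1) order.strict_trans)
        then show ?thesis using confined[of s] that e(1,3) r(1) by (simp add: dist_commute)
      qed
      then show ?thesis using that contx[OF that(2)] x'b[OF _ _ that(2)] by (simp add: sol_def solution_in_def)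
    qed
    have dom: "dist (x a) (x b) \<le> \<bar>\<phi> (x 0) a - \<phi> (x 0) b\<bar>"
      if "0 \<le> a \<and> ereal a < T" "0 \<le> b \<and> ereal b < T" for a b
    proof (cases "a \<le> b")
      case True
      then show ?thesis using travel[OF solx, of b a] that by (simp add: dist_norm norm_minus_commute)
    next
      case False
      then show ?thesis using travel[OF solx, of a b] that by (simp add: dist_norm)
    qed
    have limit_close: "dist z x0 \<le> e"
      if "(x \<longlongrightarrow> z) F" "\<forall>\<^sub>F t in F. 0 \<le> t \<and> ereal t < T" "F \<noteq> bot" for z F
    proof (rule tendsto_upperbound[OF _ _ that(3)])
      show "((\<lambda>t. dist (x t) x0) \<longlongrightarrow> dist z x0) F" using that(1) by (intro tendsto_intros)
      show "\<forall>\<^sub>F t in F. dist (x t) x0 \<le> e"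
        using that(2) by eventually_elim (use confined in \<open>auto intro: less_imp_le\<close>)
    qed
    have "T = \<infinity>"
    proof (rule ccontr)
      assume "T \<noteq> \<infinity>"
      with T obtain \<tau> where \<tau>: "T = ereal \<tau>" "0 < \<tau>" by (cases T) auto
      have ev: "\<forall>\<^sub>F t in at_left \<tau>. 0 \<le> t \<and> ereal t < T"
        using \<tau> by (auto simp: eventually_at_left[of 0] intro!: exI[of _ 0])
      have "(\<phi> (x 0) \<longlongrightarrow> \<phi> (x 0) \<tau>) (at_left \<tau>)" unfolding \<phi>_def by (intro tendsto_intros)
      from converges_if_dominated[OF this ev dom] obtain z where z: "(x \<longlongrightarrow> z) (at_left \<tau>)" by auto
      have "dist z x0 \<le> \<rho> / 2" using limit_close[OF z ev] e(4) by simp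
      then have "cball z (\<rho> / 2) \<subseteq> cball x0 \<rho>" by (simp add: cball_subset_cball_iff dist_commute)
      then have "\<Lambda>-lipschitz_on (cball z (\<rho> / 2)) f" by (rule lipschitz_on_subset[OF lip])
      moreover have "trajectory f (ereal \<tau>) x" using traj \<tau>(1) by simp
      moreover from this have "solves_forward f (ereal \<tau>) x" by (simp add: trajectory_def)
      ultimately show False using solution_extends[OF _ z cont] \<rho> by auto
    qed
    moreover have "\<exists>z\<in>E. (x \<longlongrightarrow> z) at_top"
    proof -
      have ev: "\<forall>\<^sub>F t in at_top. 0 \<le> t \<and> ereal t < T"
        using \<open>T = \<infinity>\<close> eventually_ge_at_top[of 0] by simp
      have exp0: "((\<lambda>t. exp (- \<kappa> / 2 * t)) \<longlongrightarrow> 0) at_top"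
        by (rule filterlim_compose[OF exp_at_bot])
          (rule filterlim_tendsto_neg_mult_at_bot[OF tendsto_const _ filterlim_ident], use \<kappa> in simp)
      have "(\<phi> (x 0) \<longlongrightarrow> - (2 * A (x 0) / \<kappa>) * 0) at_top" unfolding \<phi>_def by (intro tendsto_intros exp0)
      from converges_if_dominated[OF this ev dom] obtain z where z: "(x \<longlongrightarrow> z) at_top" by auto
      have "((\<lambda>t. f (x t)) \<longlongrightarrow> f z) at_top"
        using continuous_on_tendsto_compose[OF cont z] by simp
      moreover have "((\<lambda>t. f (x t)) \<longlongrightarrow> 0) at_top"
      proof (rule Lim_null_comparison)
        show "\<forall>\<^sub>F t in at_top. norm (f (x t)) \<le> A (x 0) * exp (- \<kappa> / 2 * t)"
          using eventually_ge_at_top[of 0]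
        proof eventually_elim
          case (elim t)
          \<comment> \<open>The speed bound holds strictly before the end time, hence the margin
            1.\<close>
          have "sol x (t + 1)" using elim \<open>T = \<infinity>\<close> by (intro solx) auto
          from speed[OF this elim] show ?case by simp
        qed
        show "((\<lambda>t. A (x 0) * exp (- \<kappa> / 2 * t)) \<longlongrightarrow> 0) at_top"
          using tendsto_mult_right_zero[OF exp0] .
      qed
      ultimately have "f z = 0" using tendsto_unique trivial_limit_at_top_linorder by blast
      moreover have "z \<in> ball x0 r0" using limit_close[OF z ev] e(1,3) r by (simp add: dist_commute)
      ultimately show ?thesis using inE z by blast
    qed
    ultimately show ?thesis using confined e(2) by (auto intro: less_le_trans)
  qed
  moreover have "0 < \<delta>" using \<delta>1(1) e(1) by (simp add: \<delta>_def)
  ultimately show ?thesis by blast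
qed

subsection \<open>The block matrix hypotheses\<close>

lemma positive_definiteD:
  assumes "positive_definite P" "P \<in> carrier_mat m m" "v \<in> carrier_vec m" "v \<noteq> 0\<^sub>v m"
  shows "0 < scalar_prod v (P *\<^sub>v v)"
  using assms unfolding positive_definite_def by auto

text \<open>The quadratic form of \<open>transpose_mat A * P + P * A\<close> at \<open>v\<close> is
  twice \<open>scalar_prod v (P *\<^sub>v (A *\<^sub>v v))\<close>, because \<open>P\<close> is
  symmetric.\<close>

lemma negative_definite_lyapunov:
  assumes P: "P \<in> carrier_mat m m" "positive_definite P" and A: "A \<in> carrier_mat m m"
    and neg: "negative_definite (transpose_mat A * P + P * A)" and v: "v \<in> carrier_vec m" "v \<noteq> 0\<^sub>v m"
  shows "scalar_prod v (P *\<^sub>v (A *\<^sub>v v)) < 0"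
proof -
  have PT: "transpose_mat P = P" using P(2) by (simp add: positive_definite_def)
  have AT: "transpose_mat A \<in> carrier_mat m m" using A by simp
  define L where "L = transpose_mat A * P + P * A"
  have L: "L \<in> carrier_mat m m" using P A by (simp add: L_def)
  have car: "P *\<^sub>v v \<in> carrier_vec m" "A *\<^sub>v v \<in> carrier_vec m" "P *\<^sub>v (A *\<^sub>v v) \<in> carrier_vec m"
    "transpose_mat A *\<^sub>v (P *\<^sub>v v) \<in> carrier_vec m"
    using P(1) A AT v(1) by auto
  have "L *\<^sub>v v = transpose_mat A *\<^sub>v (P *\<^sub>v v) + P *\<^sub>v (A *\<^sub>v v)"
    unfolding L_def using P(1) A AT v(1)
    by (subst add_mult_distrib_mat_vec[of _ m m]) auto
  then have "scalar_prod v (L *\<^sub>v v)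
      = scalar_prod v (transpose_mat A *\<^sub>v (P *\<^sub>v v)) + scalar_prod v (P *\<^sub>v (A *\<^sub>v v))"
    using scalar_prod_add_distrib[OF v(1) car(4,3)] by simp
  also have "scalar_prod v (transpose_mat A *\<^sub>v (P *\<^sub>v v)) = scalar_prod (transpose_mat A *\<^sub>v (P *\<^sub>v v)) v"
    by (rule comm_scalar_prod[OF v(1) car(4)])
  also have "\<dots> = scalar_prod (P *\<^sub>v v) (A *\<^sub>v v)"
    by (rule transpose_vec_mult_scalar[OF A v(1) car(1)])
  also have "\<dots> = scalar_prod v (P *\<^sub>v (A *\<^sub>v v))"
    using transpose_vec_mult_scalar[OF P(1) car(2) v(1)] by (simp add: PT)
  finally have eq: "scalar_prod v (L *\<^sub>v v) = 2 * scalar_prod v (P *\<^sub>v (A *\<^sub>v v))" by simp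
  have "0 < scalar_prod v (- L *\<^sub>v v)"
    using positive_definiteD[of "- L" m v] neg L v unfolding negative_definite_def L_def by simp
  also have "- L *\<^sub>v v = - (L *\<^sub>v v)" using L v(1) by simp
  also have "scalar_prod v (- (L *\<^sub>v v)) = - scalar_prod v (L *\<^sub>v v)"
    using L v(1) by (intro scalar_prod_uminus_right) auto
  finally show ?thesis using eq by simp
qed

lemma sum_enumeration_split:
  fixes g :: "'n::finite \<Rightarrow> 'b::comm_monoid_add" and b :: "nat \<Rightarrow> 'n"
  assumes b: "bij_betw b {..<n} UNIV" and p: "p \<le> n"
  shows "(\<Sum>k\<in>UNIV. g k) = (\<Sum>i<p. g (b i)) + (\<Sum>j<n - p. g (b (p + j)))"
proof -
  have "(\<Sum>k\<in>UNIV. g k) = (\<Sum>i<n. g (b i))" using sum.reindex_bij_betw[OF b, of g] by simp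
  also have "{..<n} = {..<p} \<union> (+) p ` {..<n - p}"
    using p by (auto simp: image_iff) (metis add_diff_inverse_nat diff_less_mono lessThan_iff not_less)
  also have "(\<Sum>i\<in>\<dots>. g (b i)) = (\<Sum>i<p. g (b i)) + (\<Sum>i\<in>(+) p ` {..<n - p}. g (b i))"
    by (rule sum.union_disjoint) auto
  also have "(\<Sum>i\<in>(+) p ` {..<n - p}. g (b i)) = (\<Sum>j<n - p. g (b (p + j)))"
    by (subst sum.reindex) auto
  finally show ?thesis .
qed

text \<open>\<open>P\<close> is \<open>Q diag(0, Pm) Q\<^sup>T\<close>.\<close>

lemma block_lyapunov_operator:
  fixes Q :: "real^'n^'n"
  assumes Q: "orthogonal_matrix Q" and p: "p \<le> CARD('n)"
    and Pm: "Pm \<in> carrier_mat (CARD('n) - p) (CARD('n) - p)" "positive_definite Pm"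
  obtains P :: "real^'n \<Rightarrow> real^'n" where "linear P" "\<And>x y. inner (P x) y = inner x (P y)"
    "\<And>x. P x \<noteq> 0 \<Longrightarrow> 0 < inner x (P x)" "dim {x. P x = 0} \<le> p"
    "\<And>A At. At \<in> carrier_mat (CARD('n) - p) (CARD('n) - p) \<Longrightarrow>
      mat_of (transpose Q ** A ** Q) =
        four_block_mat (0\<^sub>m p p) (0\<^sub>m p (CARD('n) - p)) (0\<^sub>m (CARD('n) - p) p) At \<Longrightarrow>
      negative_definite (transpose_mat At * Pm + Pm * At) \<Longrightarrow>
      (\<forall>x. (P x \<noteq> 0 \<longrightarrow> inner (P x) (A *v x) < 0) \<and> (P x = 0 \<longrightarrow> P (A *v x) = 0))"
proof -
  define m where "m = CARD('n) - p"
  define b where "b = (from_nat_into UNIV :: nat \<Rightarrow> 'n)"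
  have b: "bij_betw b {..<CARD('n)} UNIV"
    unfolding b_def by (rule bij_betw_from_nat_into_finite) simp
  define \<iota> where "\<iota> = the_inv_into {..<CARD('n)} b"
  have \<iota>b: "\<iota> (b i) = i" if "i < CARD('n)" for i
    using b that unfolding \<iota>_def by (intro the_inv_into_f_f) (auto simp: bij_betw_def)
  have Pm': "Pm \<in> carrier_mat m m" using Pm(1) by (simp add: m_def)
  have PmT: "transpose_mat Pm = Pm" using Pm(2) by (simp add: positive_definite_def)
  \<comment> \<open>\<open>tl x\<close> holds the last \<open>m\<close> coordinates of
    \<open>x\<close> in the basis given by the columns of \<open>Q\<close>, in the enumeration
    \<open>b\<close> that \<open>mat_of\<close> uses.\<close>
  define tl where "tl x = Matrix.vec m (\<lambda>j. vec_nth (transpose Q *v x) (b (p + j)))" for x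
  have tl: "tl x \<in> carrier_vec m" for x by (simp add: tl_def)
  define u where "u x = (\<chi> k. if \<iota> k < p then 0 else vec_index (Pm *\<^sub>v tl x) (\<iota> k - p))" for x
  define P where "P x = Q *v u x" for x
  have u_low: "vec_nth (u x) (b i) = 0" if "i < p" for x i
    using that p by (simp add: u_def \<iota>b)
  have u_high: "vec_nth (u x) (b (p + j)) = vec_index (Pm *\<^sub>v tl x) j" if "j < m" for x j
    using that p by (simp add: u_def \<iota>b m_def)
  \<comment> \<open>All properties of \<open>P\<close> are read off from this bilinear form;
    identities between vectors follow by testing against arbitrary vectors.\<close>
  have form: "inner x (P y) = scalar_prod (tl x) (Pm *\<^sub>v tl y)" for x y
  proof -
    have "inner x (P y) = inner (transpose Q *v x) (u y)"
      unfolding P_def by (simp add: dot_lmul_matrix[symmetric] transpose_matrix_vector)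
    also have "\<dots> = (\<Sum>k\<in>UNIV. vec_nth (transpose Q *v x) k * vec_nth (u y) k)"
      by (simp add: inner_vec_def)
    also have "\<dots> = (\<Sum>j<m. vec_nth (transpose Q *v x) (b (p + j)) * vec_index (Pm *\<^sub>v tl y) j)"
      unfolding sum_enumeration_split[OF b p] by (simp add: u_low u_high flip: m_def)
    also have "\<dots> = scalar_prod (tl x) (Pm *\<^sub>v tl y)"
      using Pm' by (simp add: scalar_prod_def tl_def atLeast0LessThan)
    finally show ?thesis .
  qed
  have sym: "inner (P x) y = inner x (P y)" for x y
  proof -
    have "inner (P x) y = scalar_prod (tl y) (Pm *\<^sub>v tl x)" by (simp add: form inner_commute)
    also have "\<dots> = scalar_prod (Pm *\<^sub>v tl y) (tl x)"
      using transpose_vec_mult_scalar[OF Pm' tl[of x] tl[of y]] by (simp add: PmT)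
    also have "\<dots> = inner x (P y)" unfolding form
      using Pm' by (intro comm_scalar_prod[of _ m]) (auto simp: tl_def)
    finally show ?thesis .
  qed
  have tl0: "P x = 0 \<longleftrightarrow> tl x = 0\<^sub>v m" for x
  proof
    assume "P x = 0"
    then have "scalar_prod (tl x) (Pm *\<^sub>v tl x) = 0" by (simp flip: form)
    then show "tl x = 0\<^sub>v m" using positive_definiteD[OF Pm(2) Pm' tl[of x]] by auto
  next
    assume "tl x = 0\<^sub>v m"
    moreover have "Pm *\<^sub>v 0\<^sub>v m = 0\<^sub>v m" using Pm' by (intro eq_vecI) auto
    ultimately have "inner (P x) (P x) = 0" using tl[of "P x"] by (simp add: form)
    then show "P x = 0" by simp
  qed
  have tl_add: "tl (x + y) = tl x + tl y" and tl_scale: "tl (c *\<^sub>R x) = smult_vec c (tl x)" for x y c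
    by (auto simp: tl_def matrix_vector_right_distrib matrix_vector_mult_scaleR)
  have "linear P"
  proof (rule linearI)
    show "P (x + y) = P x + P y" for x y
    proof (rule vector_eq_ldot[THEN iffD1], rule allI)
      show "inner z (P (x + y)) = inner z (P x + P y)" for z
        using Pm' tl by (simp add: form inner_add_right tl_add mult_add_distrib_mat_vec[of _ m m] scalar_prod_add_distrib[of _ m])
    qed
    show "P (c *\<^sub>R x) = c *\<^sub>R P x" for c x
    proof (rule vector_eq_ldot[THEN iffD1], rule allI)
      show "inner z (P (c *\<^sub>R x)) = inner z (c *\<^sub>R P x)" for z
        using Pm' tl by (simp add: form tl_scale mult_mat_vec[of _ m m] scalar_prod_smult_distrib[of _ m])
    qed
  qed
  moreover have pos: "0 < inner x (P x)" if "P x \<noteq> 0" for x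
    using that positive_definiteD[OF Pm(2) Pm' tl] by (simp add: form tl0)
  moreover have "dim {x. P x = 0} \<le> p"
  proof -
    define Z where "Z = {w :: real^'n. \<forall>k. k \<notin> b ` {..<p} \<longrightarrow> vec_nth w k = 0}"
    have "{x. P x = 0} \<subseteq> (*v) Q ` Z"
    proof
      fix x assume "x \<in> {x. P x = 0}"
      then have 0: "tl x = 0\<^sub>v m" by (simp add: tl0)
      have "vec_nth (transpose Q *v x) k = 0" if k: "k \<notin> b ` {..<p}" for k
      proof -
        obtain i where i: "i < CARD('n)" "k = b i" using b by (auto simp: bij_betw_def)
        then have "p \<le> i" using k by (metis imageI lessThan_iff not_less)
        then have "i = p + (i - p)" "i - p < m" using i p by (auto simp: m_def)
        then show ?thesis using arg_cong[OF 0, of "\<lambda>v. vec_index v (i - p)"] i(2) by (simp add: tl_def)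
      qed
      then have "transpose Q *v x \<in> Z" by (simp add: Z_def)
      moreover have "x = Q *v (transpose Q *v x)"
        unfolding matrix_vector_mul_assoc using Q by (simp add: orthogonal_matrix_def)
      ultimately show "x \<in> (*v) Q ` Z" by blast
    qed
    then have "dim {x. P x = 0} \<le> dim ((*v) Q ` Z)" by (rule dim_subset)
    also have "\<dots> \<le> dim Z" by (rule dim_image_le) simp
    also have "dim Z = card (b ` {..<p})"
      unfolding Z_def by (simp add: dim_substandard_cart flip: dim_vec_eq)
    also have "\<dots> \<le> p" using card_image_le[of "{..<p}" b] by simp
    finally show ?thesis .
  qed
  moreover have "(\<forall>x. (P x \<noteq> 0 \<longrightarrow> inner (P x) (A *v x) < 0) \<and> (P x = 0 \<longrightarrow> P (A *v x) = 0))"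
    if At: "At \<in> carrier_mat (CARD('n) - p) (CARD('n) - p)"
      and block: "mat_of (transpose Q ** A ** Q) =
        four_block_mat (0\<^sub>m p p) (0\<^sub>m p (CARD('n) - p)) (0\<^sub>m (CARD('n) - p) p) At"
      and neg: "negative_definite (transpose_mat At * Pm + Pm * At)" for A At
  proof -
    have At': "At \<in> carrier_mat m m" using At by (simp add: m_def)
    define N where "N = transpose Q ** A ** Q"
    have N: "vec_nth (vec_nth N (b i)) (b j) = four_block_mat (0\<^sub>m p p) (0\<^sub>m p m) (0\<^sub>m m p) At $$ (i, j)"
      if "i < CARD('n)" "j < CARD('n)" for i j
      using that arg_cong[OF block, of "\<lambda>M. M $$ (i, j)"] by (simp add: mat_of_def N_def b_def m_def)
    \<comment> \<open>The zero blocks make the last \<open>m\<close> coordinates of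
      \<open>A *v x\<close> depend only on those of \<open>x\<close>, through \<open>At\<close>.
      This also yields invariance of the kernel of \<open>P\<close>.\<close>
    have tlA: "tl (A *v x) = At *\<^sub>v tl x" for x
    proof (rule eq_vecI)
      fix j assume "j < dim_vec (At *\<^sub>v tl x)"
      then have j: "j < m" using At' by simp
      have "N *v (transpose Q *v x) = transpose Q *v (A *v ((Q ** transpose Q) *v x))"
        by (simp only: N_def matrix_vector_mul_assoc matrix_mul_assoc)
      also have "Q ** transpose Q = Finite_Cartesian_Product.mat 1" using Q by (simp add: orthogonal_matrix_def)
      finally have "vec_index (tl (A *v x)) j = vec_nth (N *v (transpose Q *v x)) (b (p + j))"
        using j by (simp add: tl_def)
      also have "\<dots> = (\<Sum>k\<in>UNIV. vec_nth (vec_nth N (b (p + j))) k * vec_nth (transpose Q *v x) k)"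
        by (simp add: matrix_vector_mult_def)
      also have "\<dots> = (\<Sum>l<m. At $$ (j, l) * vec_index (tl x) l)"
        unfolding sum_enumeration_split[OF b p] m_def[symmetric]
        using j p At' by (simp add: N m_def tl_def)
      also have "\<dots> = vec_index (At *\<^sub>v tl x) j"
        using j At' tl[of x] by (simp add: scalar_prod_def row_def tl_def atLeast0LessThan)
      finally show "vec_index (tl (A *v x)) j = vec_index (At *\<^sub>v tl x) j" .
    qed (use At' in \<open>simp add: tl_def\<close>)
    have "inner (P x) (A *v x) < 0" if "P x \<noteq> 0" for x
      using negative_definite_lyapunov[OF Pm' Pm(2) At' neg tl] that by (simp add: sym form tlA tl0)
    moreover have "At *\<^sub>v 0\<^sub>v m = 0\<^sub>v m" using At' by (intro eq_vecI) auto
    then have "P (A *v x) = 0" if "P x = 0" for x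
      using that by (simp add: tl0 tlA)
    ultimately show ?thesis by blast
  qed
  ultimately show thesis using sym by (intro that)
qed

text \<open>Passes from derivatives as bounded linear maps to matrices, so that the hypotheses
  indexed by \<open>I x\<close> reach the elements of \<open>J\<close>.\<close>

lemma limiting_jacobiansI:
  fixes f :: "real^'n \<Rightarrow> real^'n"
  assumes X: "X \<longlonglongrightarrow> x" and f': "\<And>k. (f has_derivative blinfun_apply (M' k)) (at (X k))" and M: "M' \<longlonglongrightarrow> M"
  shows "matrix (blinfun_apply M) \<in> limiting_jacobians f x"
proof -
  have "jacobian f (at (X k)) = matrix (blinfun_apply (M' k))" for k
    using frechet_derivative_at[OF f'[of k]] by (simp add: jacobian_def)
  moreover have "(\<lambda>k. matrix (blinfun_apply (M' k))) \<longlonglongrightarrow> matrix (blinfun_apply M)"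
    unfolding matrix_def by (intro tendsto_intros M)
  ultimately show ?thesis
    unfolding limiting_jacobians_def using X f' by (auto simp: differentiable_def intro!: exI[of _ X])
qed

theorem propositionA5:
  fixes f :: "real^'n \<Rightarrow> real^'n"
    and E :: "(real^'n) set"
    and p :: nat
    and I :: "real^'n \<Rightarrow> 'i set"
    and A :: "real^'n \<Rightarrow> 'i \<Rightarrow> real^'n^'n"
    and Q :: "real^'n \<Rightarrow> real^'n^'n"
    and At :: "real^'n \<Rightarrow> 'i \<Rightarrow> real mat"
  assumes pw: "piecewise_C2 f"
    and lip: "\<exists>U. open U \<and> E \<subseteq> U \<and> local_lipschitz (UNIV :: real set) U (\<lambda>t. f)"
    and mfd: "submanifold p E"
    and equil: "\<And>x. x \<in> E \<Longrightarrow> f x = 0"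
    and fin: "\<And>x. x \<in> E \<Longrightarrow> finite (I x)"
    and jac: "\<And>x. x \<in> E \<Longrightarrow> A x ` I x = limiting_jacobians f x"
    and orth: "\<And>x. x \<in> E \<Longrightarrow> orthogonal_matrix (Q x)"
    and dims: "\<And>x i. x \<in> E \<Longrightarrow> i \<in> I x \<Longrightarrow> At x i \<in> carrier_mat (CARD('n) - p) (CARD('n) - p)"
    and block: "\<And>x i. x \<in> E \<Longrightarrow> i \<in> I x \<Longrightarrow>
        mat_of (transpose (Q x) ** A x i ** Q x) =
        four_block_mat (0\<^sub>m p p) (0\<^sub>m p (CARD('n) - p)) (0\<^sub>m (CARD('n) - p) p) (At x i)"
    and eig: "\<And>x i z. x \<in> E \<Longrightarrow> i \<in> I x \<Longrightarrow>
        eigenvalue (map_mat complex_of_real (At x i)) z \<Longrightarrow> Re z < 0"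
    and lyap: "\<And>x. x \<in> E \<Longrightarrow>
        \<exists>P \<in> carrier_mat (CARD('n) - p) (CARD('n) - p). positive_definite P \<and>
          (\<forall>i \<in> I x. negative_definite (transpose_mat (At x i) * P + P * At x i))"
  shows "locally_asymptotically_stable f E \<and> trajectories_converge_to_point f E"
proof -
  obtain U where U: "open U" "E \<subseteq> U" and lipU: "local_lipschitz (UNIV :: real set) U (\<lambda>t. f)"
    using lip by blast
  have cont: "continuous_on UNIV f" using pw by (simp add: piecewise_C2_def)
  have "\<exists>\<delta>>0. \<forall>T y. trajectory f T y \<and> y 0 \<in> ball x \<delta> \<longrightarrow>
    T = \<infinity> \<and> (\<forall>t\<ge>0. dist (y t) x < \<epsilon>) \<and> (\<exists>z\<in>E. (y \<longlongrightarrow> z) at_top)"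
    if x: "x \<in> E" and \<epsilon>: "0 < \<epsilon>" for x \<epsilon>
  proof -
    \<comment> \<open>A chart at \<open>x\<close> supplies a subspace of dimension \<open>p\<close>,
      hence \<open>p \<le> CARD('n)\<close>, and the truncated subtraction in the block sizes is
      genuine.\<close>
    have "\<exists>S :: (real^'n) set. dim S = p" using bspec[OF mfd[unfolded submanifold_def] x] by blast
    then have p: "p \<le> CARD('n)" using dim_subset_UNIV_cart by metis
    obtain Pm where Pm: "Pm \<in> carrier_mat (CARD('n) - p) (CARD('n) - p)" "positive_definite Pm"
      and neg: "\<And>i. i \<in> I x \<Longrightarrow> negative_definite (transpose_mat (At x i) * Pm + Pm * At x i)"
      using lyap[OF x] by blast
    obtain P :: "real^'n \<Rightarrow> real^'n" where P: "linear P" "\<And>x y. inner (P x) y = inner x (P y)"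
      "\<And>x. P x \<noteq> 0 \<Longrightarrow> 0 < inner x (P x)" "dim {x. P x = 0} \<le> p"
      and PA: "\<And>A At. At \<in> carrier_mat (CARD('n) - p) (CARD('n) - p) \<Longrightarrow>
      mat_of (transpose (Q x) ** A ** Q x) =
        four_block_mat (0\<^sub>m p p) (0\<^sub>m p (CARD('n) - p)) (0\<^sub>m (CARD('n) - p) p) At \<Longrightarrow>
      negative_definite (transpose_mat At * Pm + Pm * At) \<Longrightarrow>
      (\<forall>x. (P x \<noteq> 0 \<longrightarrow> inner (P x) (A *v x) < 0) \<and> (P x = 0 \<longrightarrow> P (A *v x) = 0))"
      by (rule block_lyapunov_operator[OF orth[OF x] p Pm]) (rule that)
    obtain J where J: "finite J" "linearized_by f x J"
      "\<And>M. M \<in> J \<Longrightarrow> \<exists>X M'. X \<longlonglongrightarrow> x \<and> (\<forall>k. (f has_derivative blinfun_apply (M' k)) (at (X k))) \<and> M' \<longlonglongrightarrow> M"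
      by (rule piecewise_C2_linearized_by[OF pw]) (rule that)
    have "\<forall>v. (P v \<noteq> 0 \<longrightarrow> inner (P v) (blinfun_apply M v) < 0) \<and> (P v = 0 \<longrightarrow> P (blinfun_apply M v) = 0)"
      if "M \<in> J" for M
    proof -
      have "matrix (blinfun_apply M) \<in> limiting_jacobians f x"
        using J(3)[OF that] by (blast intro: limiting_jacobiansI)
      then obtain i where i: "i \<in> I x" "matrix (blinfun_apply M) = A x i"
        using jac[OF x] by (metis imageE)
      have "A x i *v v = blinfun_apply M v" for v
        unfolding i(2)[symmetric] by (simp add: matrix_works blinfun.bounded_linear_right bounded_linear.linear)
      with PA[OF dims[OF x i(1)] block[OF x i(1)] neg[OF i(1)]] show ?thesis by simp
    qed
    then have L: "lyapunov_for P J" using P by (simp add: lyapunov_for_def)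
    have "\<exists>u>0. \<exists>\<Lambda>. \<forall>s\<in>cball (0::real) u \<inter> UNIV. \<Lambda>-lipschitz_on (cball x u \<inter> U) f"
      using lipU x U(2) unfolding local_lipschitz_def by blast
    then obtain u \<Lambda> where u: "0 < u" "\<forall>s\<in>cball (0::real) u \<inter> UNIV. \<Lambda>-lipschitz_on (cball x u \<inter> U) f"
      by blast
    obtain \<rho> where \<rho>: "0 < \<rho>" "cball x \<rho> \<subseteq> U" using U x open_contains_cball by blast
    have "\<Lambda>-lipschitz_on (cball x (min u \<rho>)) f"
      by (rule lipschitz_on_subset[OF bspec[OF u(2), of 0]]) (use u(1) \<rho> in auto)
    from local_stability[OF mfd x equil L J(1,2) P(4) cont this _ \<epsilon>]
    show ?thesis using u(1) \<rho>(1) by simp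
  qed
  then obtain \<delta> where \<delta>: "\<And>x \<epsilon>. x \<in> E \<Longrightarrow> 0 < \<epsilon> \<Longrightarrow> 0 < \<delta> x \<epsilon>"
    and stable: "\<And>x \<epsilon> T y. x \<in> E \<Longrightarrow> 0 < \<epsilon> \<Longrightarrow> trajectory f T y \<Longrightarrow> y 0 \<in> ball x (\<delta> x \<epsilon>) \<Longrightarrow>
    T = \<infinity> \<and> (\<forall>t\<ge>0. dist (y t) x < \<epsilon>) \<and> (\<exists>z\<in>E. (y \<longlongrightarrow> z) at_top)"
    by metis
  \<comment> \<open>\<open>E\<close> need not be compact, so the radii depend on the base point. A
    union of balls still suffices, because a trajectory starting near \<open>x\<close> stays near
    that same \<open>x\<close>, which bounds its distance to \<open>E\<close>.\<close>
  define W where "W \<epsilon> = (\<Union>x\<in>E. ball x (\<delta> x \<epsilon>))" for \<epsilon>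
  have W: "open (W \<epsilon>)" "E \<subseteq> W \<epsilon>" if "0 < \<epsilon>" for \<epsilon>
    using \<delta> that by (auto simp: W_def)
  have near: "T = \<infinity> \<and> (\<forall>t\<ge>0. infdist (y t) E < \<epsilon>)" and lim: "T = \<infinity> \<and> (\<exists>z\<in>E. (y \<longlongrightarrow> z) at_top)"
    if \<epsilon>: "0 < \<epsilon>" and y: "trajectory f T y" "y 0 \<in> W \<epsilon>" for \<epsilon> T y
  proof -
    obtain x where x: "x \<in> E" "y 0 \<in> ball x (\<delta> x \<epsilon>)" using y(2) by (auto simp: W_def)
    note * = stable[OF x(1) \<epsilon> y(1) x(2)]
    then show "T = \<infinity> \<and> (\<exists>z\<in>E. (y \<longlongrightarrow> z) at_top)" by blast
    from * show "T = \<infinity> \<and> (\<forall>t\<ge>0. infdist (y t) E < \<epsilon>)"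
      using infdist_le[OF x(1)] by (meson order_le_less_trans)
  qed
  have dist0: "((\<lambda>t. infdist (y t) E) \<longlongrightarrow> 0) at_top" if "z \<in> E" "(y \<longlongrightarrow> z) at_top" for y z
    using tendsto_infdist[OF that(2), of E] that(1) by simp
  show ?thesis
    unfolding locally_asymptotically_stable_def trajectories_converge_to_point_def
  proof (intro conjI allI impI)
    show "\<exists>W. open W \<and> E \<subseteq> W \<and>
      (\<forall>T x. trajectory f T x \<and> x 0 \<in> W \<longrightarrow> T = \<infinity> \<and> (\<forall>t\<ge>0. infdist (x t) E < \<epsilon>))" if "0 < \<epsilon>" for \<epsilon>
      using W[OF that] near[OF that] by blast
    show "\<exists>W. open W \<and> E \<subseteq> W \<and>
      (\<forall>T x. trajectory f T x \<and> x 0 \<in> W \<longrightarrow> T = \<infinity> \<and> ((\<lambda>t. infdist (x t) E) \<longlongrightarrow> 0) at_top)"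
    proof (intro exI[of _ "W 1"] conjI allI impI W)
      fix T x assume traj: "trajectory f T x \<and> x 0 \<in> W 1"
      have *: "T = \<infinity> \<and> (\<exists>z\<in>E. (x \<longlongrightarrow> z) at_top)"
        by (rule lim[of 1]) (use traj in simp_all)
      then show "T = \<infinity>" by simp
      from * show "((\<lambda>t. infdist (x t) E) \<longlongrightarrow> 0) at_top" using dist0 by blast
    qed simp_all
    show "\<exists>W. open W \<and> E \<subseteq> W \<and>
      (\<forall>T x. trajectory f T x \<and> x 0 \<in> W \<longrightarrow> T = \<infinity> \<and> (\<exists>z\<in>E. (x \<longlongrightarrow> z) at_top))"
    proof (intro exI[of _ "W 1"] conjI[OF W(1) conjI[OF W(2)]] allI impI)
      show "T = \<infinity> \<and> (\<exists>z\<in>E. (x \<longlongrightarrow> z) at_top)" if "trajectory f T x \<and> x 0 \<in> W 1" for T x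
        by (rule lim[of 1]) (use that in simp_all)
    qed simp_all
  qed
qed

end
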